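(* Let $n\ge 2$ and let $m_1\ge m_2\ge\cdots\ge m_n$ be integers. Let $R$ be the associated Gelfand–Tsetlin representation space, i.e. the complex vector space with basis the Gelfand–Tsetlin patterns with top row $(m_1,\dots,m_n)$, with the Gelfand–Tsetlin action. Then $R$ is a simple $sl_n$-module.
   Context: Here $sl_n=sl_n(\mathbb{C})$ is the Lie algebra of $n\times n$ complex matrices of trace $0$. Patterns. Fix integers $m_1\ge\cdots\ge m_n$. A Gelfand–Tsetlin pattern $\xi$ with top row $(m_1,\dots,m_n)$ is a family of integers $m_{i,k}$, $1\le i\le k\le n$, with $m_{i,n}=m_i$ for all $i$ and $m_{i,k}\ge m_{i,k-1}\ge m_{i+1,k}$ for $1\le i\le k-1\le n-1$. (The entries $m_{1,k},\dots,m_{k,k}$ form the row of length $k$.) $R$ is the $\mathbb{C}$-vector space with basis the (finite) set of all such patterns. Action. Put $l_{p,q}=m_{p,q}-p$. For $2\le k\le n$ and $1\le j\le k-1$ let $\xi_{k-1,k}^{j}$ (resp. $\bar\xi_{k,k-1}^{j}$) be obtained from $\xi$ by replacing $m_{j,k-1}$ by $m_{j,k-1}+1$ (resp. $m_{j,k-1}-1$). Set $$a_{k-1,k}^j=\left[-\frac{\prod_{i=1}^k(l_{i,k}-l_{j,k-1})\prod_{i=1}^{k-2}(l_{i,k-2}-l_{j,k-1}-1)}{\prod_{i\neq j}(l_{i,k-1}-l_{j,k-1})(l_{i,k-1}-l_{j,k-1}-1)}\right]^{1/2},$$ $$b_{k,k-1}^j=\left[-\frac{\prod_{i=1}^k(l_{i,k}-l_{j,k-1}+1)\prod_{i=1}^{k-2}(l_{i,k-2}-l_{j,k-1})}{\prod_{i\neq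 j}(l_{i,k-1}-l_{j,k-1}+1)(l_{i,k-1}-l_{j,k-1})}\right]^{1/2},$$ where in the denominators $1\le i\le k-1$, empty products are $1$, and square roots are nonnegative. Operators on $R$ are defined by $$E_{k-1,k}\xi=\sum_j a_{k-1,k}^j\,\xi_{k-1,k}^j,\qquad F_{k,k-1}\xi=\sum_j b_{k,k-1}^j\,\bar\xi_{k,k-1}^j,\qquad H_{k,k}\xi=\Big(\sum_{i=1}^k m_{i,k}-\sum_{i=1}^{k-1}m_{i,k-1}\Big)\xi \ (1\le k\le n),$$ where each sum runs only over those $j$ for which the modified array is again a pattern. The matrix units $e_{k-1,k}$, $e_{k,k-1}$ act by $E_{k-1,k}$, $F_{k,k-1}$, and $e_{k,k}-e_{k+1,k+1}$ acts by $H_{k,k}-H_{k+1,k+1}$; the other off-diagonal matrix units act by iterated commutators, e.g. $E_{1,3}=[E_{1,2},E_{2,3}]$. By Gelfand and Tsetlin, this makes $R$ an $sl_n$-module. *)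

theory Defs
  imports
    Complex_Main
    "HOL-Library.Function_Algebras"
    "Jordan_Normal_Form.Matrix"
begin

definition sl :: "nat \<Rightarrow> complex mat set" where
  "sl n = {A \<in> carrier_mat n n. (\<Sum>i<n. A $$ (i, i)) = 0}"

definition commutator_mat :: "complex mat \<Rightarrow> complex mat \<Rightarrow> complex mat" where
  "commutator_mat A B = A * B - B * A"

(* The module is a subspace V of an ambient complex vector space; act X v is constrained only
   for X in sl n and v in V. *)
locale sl_module = vector_space scale
  for scale :: "complex \<Rightarrow> 'v::ab_group_add \<Rightarrow> 'v" +
  fixes n :: nat
    and V :: "'v set"
    and act :: "complex mat \<Rightarrow> 'v \<Rightarrow> 'v"
  assumes subspace_V: "subspace V"
    and act_closed: "\<lbrakk>X \<in> sl n; v \<in> V\<rbrakk> \<Longrightarrow> act X v \<in> V"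
    and act_add_right: "\<lbrakk>X \<in> sl n; v \<in> V; w \<in> V\<rbrakk> \<Longrightarrow> act X (v + w) = act X v + act X w"
    and act_scale_right: "\<lbrakk>X \<in> sl n; v \<in> V\<rbrakk> \<Longrightarrow> act X (scale c v) = scale c (act X v)"
    and act_add_left: "\<lbrakk>X \<in> sl n; Y \<in> sl n; v \<in> V\<rbrakk> \<Longrightarrow> act (X + Y) v = act X v + act Y v"
    and act_scale_left: "\<lbrakk>X \<in> sl n; v \<in> V\<rbrakk> \<Longrightarrow> act (c \<cdot>\<^sub>m X) v = scale c (act X v)"
    and act_commutator: "\<lbrakk>X \<in> sl n; Y \<in> sl n; v \<in> V\<rbrakk> \<Longrightarrow>
          act (commutator_mat X Y) v = act X (act Y v) - act Y (act X v)"
begin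

definition submodule :: "'v set \<Rightarrow> bool" where
  "submodule W \<longleftrightarrow> W \<subseteq> V \<and> subspace W \<and> (\<forall>X \<in> sl n. \<forall>w \<in> W. act X w \<in> W)"

end

locale simple_sl_module = sl_module +
  assumes nonzero: "V \<noteq> {0}"
    and simple: "submodule W \<Longrightarrow> W = {0} \<or> W = V"


type_synonym gt_array = "nat \<Rightarrow> nat \<Rightarrow> int"

(* The entry xi i k is m_{i,k}, with 1 <= i <= k <= n as in the literature. Entries outside
   this triangle are set to 0, so that a pattern is determined by its actual entries. *)
definition gt_patterns :: "nat \<Rightarrow> (nat \<Rightarrow> int) \<Rightarrow> gt_array set" where
  "gt_patterns n m = {\<xi>.
     (\<forall>i k. \<not> (1 \<le> i \<and> i \<le> k \<and> k \<le> n) \<longrightarrow> \<xi> i k = 0) \<and>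
     (\<forall>i \<in> {1..n}. \<xi> i n = m i) \<and>
     (\<forall>k \<in> {2..n}. \<forall>i \<in> {1..k - 1}. \<xi> i k \<ge> \<xi> i (k - 1) \<and> \<xi> i (k - 1) \<ge> \<xi> (i + 1) k)}"

type_synonym gt_vec = "gt_array \<Rightarrow> complex"

definition gt_scale :: "complex \<Rightarrow> gt_vec \<Rightarrow> gt_vec" where
  "gt_scale c v = (\<lambda>\<xi>. c * v \<xi>)"

definition gt_space :: "nat \<Rightarrow> (nat \<Rightarrow> int) \<Rightarrow> gt_vec set" where
  "gt_space n m = {v. \<forall>\<xi>. \<xi> \<notin> gt_patterns n m \<longrightarrow> v \<xi> = 0}"

definition gt_basis :: "gt_array \<Rightarrow> gt_vec" where
  "gt_basis \<xi> = (\<lambda>\<eta>. if \<eta> = \<xi> then 1 else 0)"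

definition gt_extend :: "nat \<Rightarrow> (nat \<Rightarrow> int) \<Rightarrow> (gt_array \<Rightarrow> gt_vec) \<Rightarrow> gt_vec \<Rightarrow> gt_vec" where
  "gt_extend n m T v = (\<Sum>\<xi> \<in> gt_patterns n m. gt_scale (v \<xi>) (T \<xi>))"

definition gt_l :: "gt_array \<Rightarrow> nat \<Rightarrow> nat \<Rightarrow> real" where
  "gt_l \<xi> p q = real_of_int (\<xi> p q - int p)"

definition gt_shift :: "nat \<Rightarrow> nat \<Rightarrow> int \<Rightarrow> gt_array \<Rightarrow> gt_array" where
  "gt_shift j k d \<xi> = \<xi>(j := (\<xi> j)(k := \<xi> j k + d))"

(* gt_a and gt_b are used only when both the array and the shifted array are patterns; then
   the denominators are nonzero and the radicands are nonnegative. *)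
definition gt_a :: "gt_array \<Rightarrow> nat \<Rightarrow> nat \<Rightarrow> real" where
  "gt_a \<xi> k j = sqrt (-
     ((\<Prod>i = 1..k. gt_l \<xi> i k - gt_l \<xi> j (k - 1)) *
      (\<Prod>i = 1..k - 2. gt_l \<xi> i (k - 2) - gt_l \<xi> j (k - 1) - 1)) /
     (\<Prod>i \<in> {1..k - 1} - {j}.
        (gt_l \<xi> i (k - 1) - gt_l \<xi> j (k - 1)) * (gt_l \<xi> i (k - 1) - gt_l \<xi> j (k - 1) - 1)))"

definition gt_b :: "gt_array \<Rightarrow> nat \<Rightarrow> nat \<Rightarrow> real" where
  "gt_b \<xi> k j = sqrt (-
     ((\<Prod>i = 1..k. gt_l \<xi> i k - gt_l \<xi> j (k - 1) + 1) *
      (\<Prod>i = 1..k - 2. gt_l \<xi> i (k - 2) - gt_l \<xi> j (k - 1))) /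
     (\<Prod>i \<in> {1..k - 1} - {j}.
        (gt_l \<xi> i (k - 1) - gt_l \<xi> j (k - 1) + 1) * (gt_l \<xi> i (k - 1) - gt_l \<xi> j (k - 1))))"

(* gt_E n m k is E_{k-1,k} and gt_F n m k is F_{k,k-1}, for 2 <= k <= n. *)
definition gt_E :: "nat \<Rightarrow> (nat \<Rightarrow> int) \<Rightarrow> nat \<Rightarrow> gt_vec \<Rightarrow> gt_vec" where
  "gt_E n m k = gt_extend n m (\<lambda>\<xi>.
     \<Sum>j \<in> {j \<in> {1..k - 1}. gt_shift j (k - 1) 1 \<xi> \<in> gt_patterns n m}.
       gt_scale (complex_of_real (gt_a \<xi> k j)) (gt_basis (gt_shift j (k - 1) 1 \<xi>)))"

definition gt_F :: "nat \<Rightarrow> (nat \<Rightarrow> int) \<Rightarrow> nat \<Rightarrow> gt_vec \<Rightarrow> gt_vec" where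
  "gt_F n m k = gt_extend n m (\<lambda>\<xi>.
     \<Sum>j \<in> {j \<in> {1..k - 1}. gt_shift j (k - 1) (- 1) \<xi> \<in> gt_patterns n m}.
       gt_scale (complex_of_real (gt_b \<xi> k j)) (gt_basis (gt_shift j (k - 1) (- 1) \<xi>)))"

definition gt_H :: "nat \<Rightarrow> (nat \<Rightarrow> int) \<Rightarrow> nat \<Rightarrow> gt_vec \<Rightarrow> gt_vec" where
  "gt_H n m k = gt_extend n m (\<lambda>\<xi>.
     gt_scale (of_int ((\<Sum>i = 1..k. \<xi> i k) - (\<Sum>i = 1..k - 1. \<xi> i (k - 1)))) (gt_basis \<xi>))"

definition commutator_op :: "(gt_vec \<Rightarrow> gt_vec) \<Rightarrow> (gt_vec \<Rightarrow> gt_vec) \<Rightarrow> gt_vec \<Rightarrow> gt_vec" where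
  "commutator_op S T = (\<lambda>v. S (T v) - T (S v))"

(* The operator of the off-diagonal matrix unit e_{p,q}; only p \<noteq> q is meant. The recursion is
   e_{p,q} = [e_{p,q-1}, e_{q-1,q}] above and e_{p,q} = [e_{p,p-1}, e_{p-1,q}] below the diagonal. *)
function gt_unit :: "nat \<Rightarrow> (nat \<Rightarrow> int) \<Rightarrow> nat \<Rightarrow> nat \<Rightarrow> gt_vec \<Rightarrow> gt_vec" where
  "gt_unit n m p q =
     (if q = p + 1 then gt_E n m q
      else if p = q + 1 then gt_F n m p
      else if p < q then commutator_op (gt_unit n m p (q - 1)) (gt_unit n m (q - 1) q)
      else if q < p then commutator_op (gt_unit n m p (p - 1)) (gt_unit n m (p - 1) q)
      else (\<lambda>v. 0))"
  by pat_completeness auto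
termination
  by (relation "Wellfounded.measure (\<lambda>(n, m, p, q). (p - q) + (q - p))") auto

declare gt_unit.simps [simp del]

(* A trace-zero X is the sum of X_{p,q} e_{p,q} over p \<noteq> q and of
   (X_{1,1} + ... + X_{k,k}) (e_{k,k} - e_{k+1,k+1}) over 1 <= k < n.
   Matrix indices of type mat start at 0, hence the shifts by 1. *)
definition gt_action :: "nat \<Rightarrow> (nat \<Rightarrow> int) \<Rightarrow> complex mat \<Rightarrow> gt_vec \<Rightarrow> gt_vec" where
  "gt_action n m X v =
     (\<Sum>p = 1..n. \<Sum>q \<in> {1..n} - {p}. gt_scale (X $$ (p - 1, q - 1)) (gt_unit n m p q v)) +
     (\<Sum>k = 1..n - 1. gt_scale (\<Sum>i = 1..k. X $$ (i - 1, i - 1)) (gt_H n m k v - gt_H n m (k + 1) v))"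

end

(* The operators E, F, H satisfy the relations of gl_n between Chevalley generators: after squaring
   the coefficients, [E_r, F_r] = H_r - H_{r+1} becomes Lagrange's identity
   sum_j prod_i (nu_i - rho_j) / prod_{i \<noteq> j} (rho_i - rho_j) = sum_j (nu_j - rho_j).
   The Serre relations need no computation: R is finite-dimensional, so ad E_r is nilpotent, and
   sl_2-theory makes ad E_r to the power c + 1 vanish on any lowest weight vector of weight -c.
   All relations between iterated commutators follow.

   For simplicity, comparing rows from the bottom up shows that a vector killed by every E_r is a
   multiple of the basis vector of the pattern whose entries are all as large as possible. Every
   nonzero E-stable subspace contains such a vector. Since F_r is the transpose of E_r, the
   orthogonal complement of a proper nonzero submodule W is E-stable and nonzero, so W and its
   complement share a basis vector, although that vector is not orthogonal to itself. *)
theory Submission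
  imports Defs
begin


section \<open>Commutator relations from Chevalley generators\<close>

text \<open>R must be shown to be a module for all of sl_n, although only adjacent units are given
  by formulas. Verifying a double bracket such as [E_r, [E_r, E_{r+1}]] = 0 directly on patterns
  would mean long identities between square roots. Nilpotency and the brackets with F_r force it
  instead, so square roots enter only through [E_r, F_s]: its diagonal entries involve their
  squares, and off the diagonal two products of two coefficients are compared by one exchange
  identity. The operators H_k are kept apart as for gl_n, which gives one formula for the bracket of
  any two units; trace zero is what lets the prescribed action be rewritten as a sum over all units.
  Coefficients are extended by 0 to arrays that are not patterns, so that sums run over all j; the
  boundary cases with vanishing denominators have to agree with this convention. The form used for
  the complement is bilinear, without conjugation. It has isotropic vectors in general, so W might
  meet its complement, and the contradiction has to come from a vector that pairs to 1 with
  itself.\<close>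

definition br :: "'r::ring_1 \<Rightarrow> 'r \<Rightarrow> 'r" where
  "br x y = x * y - y * x"

lemma br_self [simp]: "br x x = 0"
  and br_zero [simp]: "br 0 x = 0" "br x 0 = 0"
  and br_diff: "br (x - y) z = br x z - br y z" "br x (y - z) = br x y - br x z"
  and br_minus: "br (- x) y = - br x y" "br x (- y) = - br x y"
  by (simp_all add: br_def algebra_simps)

lemma br_of_int: "br (of_int c * x) y = of_int c * br x y" "br x (of_int c * y) = of_int c * br x y"
proof -
  have "y * (of_int c * x) = of_int c * (y * x)"
    by (metis mult.assoc Ints_of_int mult_of_int_commute)
  moreover have "x * (of_int c * y) = of_int c * (x * y)"
    by (metis mult.assoc Ints_of_int mult_of_int_commute)
  ultimately show "br (of_int c * x) y = of_int c * br x y" "br x (of_int c * y) = of_int c * br x y"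
    by (simp_all add: br_def algebra_simps)
qed

lemma br_commute: "br x y = - br y x"
  by (simp add: br_def)

lemma br_eq_0_commute: "br x y = 0 \<Longrightarrow> br y x = 0"
  using br_commute[of y x] by simp

lemma br_jacobi: "br x (br y z) = br (br x y) z + br y (br x z)"
  by (simp add: br_def algebra_simps)

text \<open>Expanding the brackets spreads \<open>k\<close> factors \<open>e\<close> over the two
  sides of \<open>x\<close>; with at least \<open>2 * N\<close> factors in all, one side contains
  \<open>e ^ N\<close>. The outer powers make the induction close, since a bracket adds one factor
  on either side.\<close>

lemma nilpotent_br_funpow:
  assumes "e ^ N = 0" and "a + b + k \<ge> 2 * N"
  shows "e ^ a * ((br e ^^ k) x) * e ^ b = 0"
  using assms(2)
proof (induction k arbitrary: a b)
  case 0
  then have "a \<ge> N \<or> b \<ge> N" by auto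
  then have "e ^ a = 0 \<or> e ^ b = 0"
    using assms(1) by (metis le_add_diff_inverse mult_zero_left power_add)
  then show ?case by auto
next
  case (Suc k)
  have "e ^ a * ((br e ^^ Suc k) x) * e ^ b
      = e ^ Suc a * ((br e ^^ k) x) * e ^ b - e ^ a * ((br e ^^ k) x) * e ^ Suc b"
    by (simp only: power_Suc2[of e a] power_Suc[of e b] funpow.simps o_apply br_def)
      (simp add: algebra_simps)
  with Suc.IH[of "Suc a" b] Suc.IH[of a "Suc b"] Suc.prems show ?case by simp
qed

text \<open>Along the string raised from \<open>x\<close>, bracketing with \<open>f\<close> returns
  \<open>w (Suc k)\<close> to \<open>w k\<close> with factor (k + 1)(c - k). Beyond \<open>c\<close>
  this factor is a nonzero integer, so a nonzero \<open>w (Suc c)\<close> would start an endless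
  string of nonzero elements, which nilpotency of \<open>e\<close> forbids. Torsion-freeness allows
  the integer factor to be cancelled.\<close>

lemma lowest_weight_vanishing:
  fixes e f h x :: "'r::ring_1"
  assumes torsion_free: "\<And>(k::nat) (y::'r). of_nat (Suc k) * y = 0 \<Longrightarrow> y = 0"
    and "br e f = h" and "br h e = 2 * e" and nil: "e ^ N = 0"
    and "br f x = 0" and "br h x = of_int (- int c) * x"
  shows "(br e ^^ Suc c) x = 0"
proof (rule ccontr)
  assume neq: "(br e ^^ Suc c) x \<noteq> 0"
  define w where "w k = (br e ^^ k) x" for k
  have wSuc: "w (Suc k) = br e (w k)" for k by (simp add: w_def)
  have weight: "br h (w k) = of_int (2 * int k - int c) * w k" for k
  proof (induction k)
    case 0 with assms(6) show ?case by (simp add: w_def)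
  next
    case (Suc k)
    have "br h (w (Suc k)) = br (br h e) (w k) + br e (br h (w k))"
      unfolding wSuc by (rule br_jacobi)
    also have "\<dots> = of_int 2 * br e (w k) + of_int (2 * int k - int c) * br e (w k)"
      using assms(3) br_of_int(1)[of 2 e] by (simp only: Suc br_of_int(2)) simp
    also have "\<dots> = of_int (2 * int (Suc k) - int c) * w (Suc k)"
      by (simp add: wSuc distrib_right[symmetric] del: of_int_diff) (simp add: algebra_simps)
    finally show ?case .
  qed
  have lower: "br f (w (Suc k)) = of_int (int (Suc k) * (int c - int k)) * w k" for k
  proof (induction k)
    case 0
    have "br f (w (Suc 0)) = br (br f e) (w 0) + br e (br f (w 0))"
      unfolding wSuc by (rule br_jacobi)
    also have "br f e = - h" using assms(2) br_commute by metis
    finally show ?case using weight[of 0] assms(5) by (simp add: w_def br_minus)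
  next
    case (Suc k)
    have "br f (w (Suc (Suc k))) = br (br f e) (w (Suc k)) + br e (br f (w (Suc k)))"
      unfolding wSuc[of "Suc k"] by (rule br_jacobi)
    also have "br f e = - h" using assms(2) br_commute by metis
    also have "br (- h) (w (Suc k)) = of_int (- (2 * int (Suc k) - int c)) * w (Suc k)"
      by (simp only: br_minus weight of_int_minus mult_minus_left)
    also have "br e (br f (w (Suc k))) = of_int (int (Suc k) * (int c - int k)) * w (Suc k)"
      by (simp only: Suc br_of_int) (simp only: wSuc)
    finally show ?case
      by (simp only: distrib_right[symmetric] of_int_add[symmetric]) (simp add: algebra_simps)
  qed
  have "w k \<noteq> 0" if "k \<ge> Suc c" for k using that
  proof (induction k rule: dec_induct)
    case base with neq show ?case by (simp add: w_def)
  next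
    case (step k)
    show ?case
    proof
      assume "w (Suc k) = 0"
      with lower[of k] have 0: "of_int (int (Suc k) * (int c - int k)) * w k = 0" by simp
      \<comment> \<open>For k > c the factor in \<open>lower\<close> is negative, while
        torsion-freeness concerns positive multiples; hence the change of sign.\<close>
      have "int (Suc k) * (int k - int c) = - (int (Suc k) * (int c - int k))"
        by (simp add: algebra_simps)
      then have *: "of_int (int (Suc k) * (int k - int c)) * w k = 0"
        using 0 by (simp only: of_int_minus mult_minus_left neg_equal_0_iff_equal)
      have "int (Suc k) * (int k - int c) > 0" using step by simp
      then obtain j where "int (Suc k) * (int k - int c) = int (Suc j)"
        by (metis pos_int_cases gr0_conv_Suc)
      with * have "of_nat (Suc j) * w k = 0" by (metis of_int_of_nat_eq)
      with torsion_free step show False by blast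
    qed
  qed
  from this[of "Suc c + 2 * N"] nilpotent_br_funpow[OF nil, of 0 0 "Suc c + 2 * N" x]
  show False by (simp add: w_def)
qed


text \<open>\<open>u p q\<close> is to be the operator of e_{p,q}, with H_p as \<open>u p p\<close>.
  Relations are assumed for adjacent and diagonal units only; the others are iterated commutators,
  formed as in the prescribed action. Nilpotency stands in for the Serre relations.\<close>

locale gl_generators =
  fixes n :: nat and u :: "nat \<Rightarrow> nat \<Rightarrow> 'r::ring_1"
  assumes torsion_free: "of_nat (Suc k) * (y::'r) = 0 \<Longrightarrow> y = 0"
    and upper: "\<lbrakk>1 \<le> p; p < q; q < n\<rbrakk> \<Longrightarrow> u p (Suc q) = br (u p q) (u q (Suc q))"
    and lower: "\<lbrakk>1 \<le> q; q < p; p < n\<rbrakk> \<Longrightarrow> u (Suc p) q = br (u (Suc p) p) (u p q)"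
    and diag_commute: "\<lbrakk>1 \<le> p; p \<le> n; 1 \<le> q; q \<le> n\<rbrakk> \<Longrightarrow> br (u p p) (u q q) = 0"
    and weight_E: "\<lbrakk>1 \<le> i; i < n; 1 \<le> k; k \<le> n\<rbrakk> \<Longrightarrow>
      br (u k k) (u i (Suc i)) = of_int (of_bool (k = i) - of_bool (k = Suc i)) * u i (Suc i)"
    and weight_F: "\<lbrakk>1 \<le> i; i < n; 1 \<le> k; k \<le> n\<rbrakk> \<Longrightarrow>
      br (u k k) (u (Suc i) i) = of_int (of_bool (k = Suc i) - of_bool (k = i)) * u (Suc i) i"
    and br_E_F: "\<lbrakk>1 \<le> i; i < n; 1 \<le> j; j < n\<rbrakk> \<Longrightarrow>
      br (u i (Suc i)) (u (Suc j) j) = (if i = j then u i i - u (Suc i) (Suc i) else 0)"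
    and nilpotent_E: "\<lbrakk>1 \<le> i; i < n\<rbrakk> \<Longrightarrow> \<exists>N. u i (Suc i) ^ N = 0"
    and nilpotent_F: "\<lbrakk>1 \<le> i; i < n\<rbrakk> \<Longrightarrow> \<exists>N. u (Suc i) i ^ N = 0"
begin

lemma br_F_E:
  assumes "1 \<le> i" "i < n" "1 \<le> j" "j < n"
  shows "br (u (Suc j) j) (u i (Suc i)) = (if i = j then u (Suc i) (Suc i) - u i i else 0)"
  using br_E_F[OF assms] by (subst br_commute) simp

text \<open>The symmetry exchanging raising and lowering generators halves the work below.\<close>

lemma transpose_generators: "gl_generators n (\<lambda>p q. - u q p)"
proof
  fix p q assume "1 \<le> p" "p < q" "q < n"
  then show "- u (Suc q) p = br (- u q p) (- u (Suc q) q)"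
    by (simp only: br_minus lower minus_minus) (subst br_commute, simp)
next
  fix p q assume "1 \<le> q" "q < p" "p < n"
  then show "- u q (Suc p) = br (- u p (Suc p)) (- u q p)"
    by (simp only: br_minus upper minus_minus) (subst br_commute, simp)
next
  fix i assume "1 \<le> i" "i < n"
  with nilpotent_F obtain N where "u (Suc i) i ^ N = 0" by blast
  then have "(- u (Suc i) i) ^ N = 0" by (simp add: power_minus[of "u (Suc i) i"])
  then show "\<exists>N. (- u (Suc i) i) ^ N = 0" ..
next
  fix i assume "1 \<le> i" "i < n"
  with nilpotent_E obtain N where "u i (Suc i) ^ N = 0" by blast
  then have "(- u i (Suc i)) ^ N = 0" by (simp add: power_minus[of "u i (Suc i)"])
  then show "\<exists>N. (- u i (Suc i)) ^ N = 0" ..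
next
  fix i j assume "1 \<le> i" "i < n" "1 \<le> j" "j < n"
  then show "br (- u (Suc i) i) (- u j (Suc j)) = (if i = j then - u i i - - u (Suc i) (Suc i) else 0)"
    by (auto simp: br_minus br_F_E)
next
  fix i k assume "1 \<le> i" "i < n" "1 \<le> k" "k \<le> n"
  from weight_F[OF this]
  show "br (- u k k) (- u (Suc i) i) = of_int (of_bool (k = i) - of_bool (k = Suc i)) * - u (Suc i) i"
    by (simp only: br_minus) (auto simp: algebra_simps)
next
  fix i k assume "1 \<le> i" "i < n" "1 \<le> k" "k \<le> n"
  from weight_E[OF this]
  show "br (- u k k) (- u i (Suc i)) = of_int (of_bool (k = Suc i) - of_bool (k = i)) * - u i (Suc i)"
    by (simp only: br_minus) (auto simp: algebra_simps)
qed (simp_all add: torsion_free diag_commute br_minus)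

lemma weight_upper:
  assumes "1 \<le> p" "p < q" "q \<le> n" "1 \<le> k" "k \<le> n"
  shows "br (u k k) (u p q) = of_int (of_bool (k = p) - of_bool (k = q)) * u p q"
  using Suc_leI[OF assms(2)] assms(3)
proof (induction q rule: dec_induct)
  case base with assms show ?case by (simp only: weight_E)
next
  case (step q)
  then have q: "p < q" "q < n" by auto
  have "br (u k k) (u p (Suc q)) = br (br (u k k) (u p q)) (u q (Suc q)) + br (u p q) (br (u k k) (u q (Suc q)))"
    by (simp only: upper[OF assms(1) q]) (rule br_jacobi)
  also have "\<dots> = of_int (of_bool (k = p) - of_bool (k = q)) * br (u p q) (u q (Suc q)) +
      of_int (of_bool (k = q) - of_bool (k = Suc q)) * br (u p q) (u q (Suc q))"
    using step q assms by (simp only: br_of_int weight_E less_imp_le)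
  also have "\<dots> = of_int (of_bool (k = p) - of_bool (k = Suc q)) * u p (Suc q)"
    by (simp only: upper[OF assms(1) q] distrib_right[symmetric] of_int_add[symmetric]) simp
  finally show ?case .
qed

text \<open>Integral weights \<open>a\<close> and \<open>b\<close> under H_i and H_{i+1} give weight
  a - b = -c for the sl_2-triple at \<open>i\<close>. The case c = 0 yields commutation, the case c
  = 1 the Serre relations.\<close>

lemma lowest_weight_E:
  assumes "1 \<le> i" "i < n" "br (u (Suc i) i) x = 0"
    and "br (u i i) x = of_int a * x" "br (u (Suc i) (Suc i)) x = of_int b * x" "b - a = int c"
  shows "(br (u i (Suc i)) ^^ Suc c) x = 0"
proof -
  obtain N where N: "u i (Suc i) ^ N = 0" using nilpotent_E assms by blast
  have "br (u i i - u (Suc i) (Suc i)) (u i (Suc i)) = 2 * u i (Suc i)"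
    using assms(1,2) by (simp add: br_diff weight_E mult_2)
  moreover have "br (u i i - u (Suc i) (Suc i)) x = of_int (- int c) * x"
    by (simp only: br_diff assms(4,5) left_diff_distrib[symmetric] of_int_diff[symmetric] assms(6)[symmetric]) simp
  ultimately show ?thesis
    using br_E_F[of i i] assms(1,2,3)
    by (intro lowest_weight_vanishing[OF torsion_free _ _ N, where f = "u (Suc i) i"
        and h = "u i i - u (Suc i) (Suc i)"]) simp_all
qed

text \<open>For distinct and non-adjacent \<open>i\<close> and \<open>j\<close>,
  \<open>u j (Suc j)\<close> is killed by the lowering generator at \<open>i\<close> and has weight
  0 there, so the first bracket already vanishes.\<close>

lemma br_E_E_far:
  assumes "1 \<le> i" "i < n" "1 \<le> j" "j < n" "i \<noteq> Suc j" "j \<noteq> Suc i"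
  shows "br (u i (Suc i)) (u j (Suc j)) = 0"
proof (cases "i = j")
  case False
  have "br (u (Suc i) i) (u j (Suc j)) = 0"
    using assms False by (simp add: br_F_E)
  moreover have "br (u i i) (u j (Suc j)) = of_int 0 * u j (Suc j)"
    "br (u (Suc i) (Suc i)) (u j (Suc j)) = of_int 0 * u j (Suc j)"
    using assms False by (subst weight_E; simp)+
  ultimately show ?thesis using lowest_weight_E[of i "u j (Suc j)" 0 0 0] assms by simp
qed simp

lemma br_E_upper_far:
  assumes "1 \<le> r" "r < s" "s \<le> n" "1 \<le> j" "j < n" "s < j \<or> Suc j < r"
  shows "br (u j (Suc j)) (u r s) = 0"
  using Suc_leI[OF assms(2)] assms(3,6)
proof (induction s rule: dec_induct)
  case base with assms show ?case by (intro br_E_E_far) auto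
next
  case (step q)
  then have "br (u j (Suc j)) (u q (Suc q)) = 0" "br (u j (Suc j)) (u r q) = 0"
    using assms by (auto intro!: br_E_E_far step.IH)
  with step assms show ?case
    using br_jacobi[of "u j (Suc j)" "u r q" "u q (Suc q)"] by (simp add: upper)
qed

text \<open>Lowering is treated before raising: it needs only the assumed relations, weights and the
  commutation of distant raising generators, and it supplies the lowest weight vectors on which
  \<open>br_E_upper\<close> rests.\<close>

lemma br_F_upper:
  assumes "1 \<le> r" "r < s" "s \<le> n" "1 \<le> i" "i < n"
  shows "br (u (Suc i) i) (u r s) =
    (if i = r then u (Suc i) s else 0) - (if s = Suc i then u r i else 0)"
  using Suc_leI[OF assms(2)] assms(3)
proof (induction s rule: dec_induct)
  case base
  with assms show ?case
    by (auto simp: br_F_E)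
next
  case (step q)
  have EF: "br (u (Suc i) i) (u q (Suc q)) = (if i = q then u (Suc i) (Suc i) - u i i else 0)"
    using assms step by (auto simp: br_F_E)
  have IH: "br (u (Suc i) i) (u r q) = (if i = r then u (Suc i) q else 0) - (if q = Suc i then u r i else 0)"
    using step by simp
  have first: "br (u (Suc r) q) (u q (Suc q)) = u (Suc r) (Suc q)"
  proof (cases "q = Suc r")
    case True then show ?thesis using step assms weight_E[of q q] by simp
  next
    case False then show ?thesis using step assms upper[of "Suc r" q] by simp
  qed
  have second: "br (u r i) (u q (Suc q)) = 0" if "q = Suc i"
  proof (cases "i = r")
    case True then show ?thesis using that step assms weight_E[of q i] by simp
  next
    case False then show ?thesis using that step assms
      by (intro br_eq_0_commute[OF br_E_upper_far]) auto
  qed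
  have third: "br (u r q) (u (Suc q) (Suc q) - u q q) = - u r q"
    using br_commute[of "u r q" "u (Suc q) (Suc q) - u q q"] step assms
      weight_upper[of r q "Suc q"] weight_upper[of r q q]
    by (simp add: br_diff)
  have "br (u (Suc i) i) (u r (Suc q)) =
      br (br (u (Suc i) i) (u r q)) (u q (Suc q)) + br (u r q) (br (u (Suc i) i) (u q (Suc q)))"
    using upper[of r q] br_jacobi[of "u (Suc i) i" "u r q" "u q (Suc q)"] step assms by simp
  with first second third IH EF show ?case using step
    by (auto simp: br_diff)
qed

text \<open>The recursion from the other end. Jacobi carries the bracket inside because
  \<open>u r (Suc r)\<close> commutes with \<open>u q (Suc q)\<close> for q > r + 1.\<close>

lemma upper_left:
  assumes "1 \<le> r" "Suc r < s" "s \<le> n"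
  shows "u r s = br (u r (Suc r)) (u (Suc r) s)"
  using Suc_leI[OF assms(2)] assms(3)
proof (induction s rule: dec_induct)
  case base with assms show ?case by (simp add: upper)
next
  case (step q)
  have "br (u r (Suc r)) (u (Suc r) (Suc q)) =
    br (br (u r (Suc r)) (u (Suc r) q)) (u q (Suc q)) + br (u (Suc r) q) (br (u r (Suc r)) (u q (Suc q)))"
    using upper[of "Suc r" q] br_jacobi[of "u r (Suc r)" "u (Suc r) q" "u q (Suc q)"] step assms by simp
  also have "br (u r (Suc r)) (u q (Suc q)) = 0"
    using step assms by (intro br_E_E_far) auto
  also have "br (u r (Suc r)) (u (Suc r) q) = u r q" using step by simp
  finally show ?case using upper[of r q] step assms by simp
qed

text \<open>Where the index ranges touch, the bracket is one of the two recursions; where they are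
  far apart or equal, it is 0. The remaining cases are of Serre type. At \<open>i\<close>, the
  vectors \<open>u (Suc i) s\<close> and \<open>u r i\<close> have lowest weight -1, so their second
  bracket vanishes, and their first one is \<open>u r s\<close> up to sign. If both \<open>i\<close>
  and \<open>Suc i\<close> lie strictly between \<open>r\<close> and \<open>s\<close>, the lowest
  weight is 0 and one bracket suffices.\<close>

lemma br_E_upper:
  assumes "1 \<le> r" "r < s" "s \<le> n" "1 \<le> i" "i < n"
  shows "br (u i (Suc i)) (u r s) =
    (if Suc i = r then u i s else 0) - (if s = i then u r (Suc i) else 0)"
proof -
  consider "s = i" | "Suc i = r" | "s < i \<or> Suc i < r" | "i = r" "s = Suc i"
    | "i = r" "Suc i < s" | "r < i" "s = Suc i" | "r < i" "Suc i < s"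
    using assms(2) by linarith
  then show ?thesis
  proof cases
    case 1
    then show ?thesis using upper[of r s] assms br_commute[of "u i (Suc i)" "u r s"] by simp
  next
    case 2
    then show ?thesis using upper_left[of i s] assms by simp
  next
    case 3
    then show ?thesis using br_E_upper_far[of r s i] assms by auto
  next
    case 4
    then show ?thesis by simp
  next
    case 5
    have "br (u (Suc i) i) (u (Suc i) s) = 0"
      using assms 5 by (subst br_F_upper) auto
    moreover have "br (u i i) (u (Suc i) s) = of_int 0 * u (Suc i) s"
      "br (u (Suc i) (Suc i)) (u (Suc i) s) = of_int 1 * u (Suc i) s"
      using assms 5 by (subst weight_upper; simp)+
    ultimately have "(br (u i (Suc i)) ^^ Suc 1) (u (Suc i) s) = 0"
      using assms by (intro lowest_weight_E[of i _ 0 1]) auto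
    then show ?thesis using upper_left[of r s] assms 5 by simp
  next
    case 6
    have "br (u (Suc i) i) (u r i) = 0"
      using assms 6 by (subst br_F_upper) auto
    moreover have "br (u i i) (u r i) = of_int (- 1) * u r i"
      "br (u (Suc i) (Suc i)) (u r i) = of_int 0 * u r i"
      using assms 6 by (subst weight_upper; simp)+
    ultimately have "(br (u i (Suc i)) ^^ Suc 1) (u r i) = 0"
      using assms by (intro lowest_weight_E[of i _ "- 1" 0]) auto
    then show ?thesis
      using upper[of r i] assms 6 br_commute[of "u r i" "u i (Suc i)"] by (simp add: br_minus)
  next
    case 7
    have "br (u (Suc i) i) (u r s) = 0"
      using assms 7 by (subst br_F_upper) auto
    moreover have "br (u i i) (u r s) = of_int 0 * u r s"
      "br (u (Suc i) (Suc i)) (u r s) = of_int 0 * u r s"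
      using assms 7 by (subst weight_upper; simp)+
    ultimately have "(br (u i (Suc i)) ^^ Suc 0) (u r s) = 0"
      using assms by (intro lowest_weight_E[of i _ 0 0]) auto
    then show ?thesis using 7 assms by simp
  qed
qed

text \<open>The minus sign turns the transpose, which reverses brackets, into an automorphism. Under
  it \<open>br_F_upper\<close> describes raising on lower units, and \<open>br_E_upper\<close>
  lowering on them.\<close>

interpretation transposed: gl_generators n "\<lambda>p q. - u q p"
  by (rule transpose_generators)

lemma weight_unit:
  assumes "1 \<le> k" "k \<le> n" "1 \<le> p" "p \<le> n" "1 \<le> q" "q \<le> n"
  shows "br (u k k) (u p q) = (if k = p then u p q else 0) - (if k = q then u p q else 0)"
proof -
  consider "p < q" | "p = q" | "q < p" by linarith
  then show ?thesis
  proof cases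
    case 1 then show ?thesis using weight_upper[of p q k] assms by auto
  next
    case 2 then show ?thesis using diag_commute[of k p] assms by auto
  next
    case 3 then show ?thesis using transposed.weight_upper[of q p k] assms
      by (auto simp: br_minus)
  qed
qed

lemma br_E_unit:
  assumes "1 \<le> r" "r \<le> n" "1 \<le> s" "s \<le> n" "1 \<le> i" "i < n"
  shows "br (u i (Suc i)) (u r s) =
    (if Suc i = r then u i s else 0) - (if s = i then u r (Suc i) else 0)"
proof -
  consider "r < s" | "r = s" | "s < r" by linarith
  then show ?thesis
  proof cases
    case 1 then show ?thesis using br_E_upper[of r s i] assms by simp
  next
    case 2 then show ?thesis using weight_unit[of r i "Suc i"] assms
      br_commute[of "u i (Suc i)" "u r r"] by auto
  next
    case 3 then show ?thesis using transposed.br_F_upper[of s r i] assms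
      by (auto simp: br_minus)
  qed
qed

lemma br_F_unit:
  assumes "1 \<le> r" "r \<le> n" "1 \<le> s" "s \<le> n" "1 \<le> i" "i < n"
  shows "br (u (Suc i) i) (u r s) =
    (if i = r then u (Suc i) s else 0) - (if s = Suc i then u r i else 0)"
proof -
  consider "r < s" | "r = s" | "s < r" by linarith
  then show ?thesis
  proof cases
    case 1 then show ?thesis using br_F_upper[of r s i] assms by simp
  next
    case 2 then show ?thesis using weight_unit[of r "Suc i" i] assms
      br_commute[of "u (Suc i) i" "u r r"] by auto
  next
    case 3 then show ?thesis using transposed.br_E_upper[of s r i] assms
      by (auto simp: br_minus)
  qed
qed

text \<open>By Jacobi, two units whose brackets with all units are known determine those of their
  commutator. The stray terms \<open>u t t\<close> and \<open>u p q\<close> cancel in pairs.\<close>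

lemma br_unit_aux:
  assumes "\<And>r s. \<lbrakk>1 \<le> r; r \<le> n; 1 \<le> s; s \<le> n\<rbrakk> \<Longrightarrow>
      br (u p t) (u r s) = (if t = r then u p s else 0) - (if s = p then u r t else 0)"
    and "\<And>r s. \<lbrakk>1 \<le> r; r \<le> n; 1 \<le> s; s \<le> n\<rbrakk> \<Longrightarrow>
      br (u t q) (u r s) = (if q = r then u t s else 0) - (if s = t then u r q else 0)"
    and "1 \<le> p" "p \<le> n" "1 \<le> q" "q \<le> n" "1 \<le> t" "t \<le> n" "p \<noteq> q" "1 \<le> r" "r \<le> n" "1 \<le> s" "s \<le> n"
  shows "br (br (u p t) (u t q)) (u r s) = (if q = r then u p s else 0) - (if s = p then u r q else 0)"
proof -
  have "br (br (u p t) (u t q)) (u r s) = br (u p t) (br (u t q) (u r s)) - br (u t q) (br (u p t) (u r s))"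
    using br_jacobi[of "u p t" "u t q" "u r s"] by simp
  also have "br (u p t) (br (u t q) (u r s)) =
      (if q = r then br (u p t) (u t s) else 0) - (if s = t then br (u p t) (u r q) else 0)"
    using assms(3-) by (simp add: assms(2) br_diff)
  also have "br (u t q) (br (u p t) (u r s)) =
      (if t = r then br (u t q) (u p s) else 0) - (if s = p then br (u t q) (u r t) else 0)"
    using assms(3-) by (simp add: assms(1) br_diff)
  also have "br (u p t) (u t s) = u p s - (if s = p then u t t else 0)"
    using assms(3-) by (simp add: assms(1))
  also have "br (u p t) (u r q) = (if t = r then u p q else 0)"
    using assms(3-) by (simp add: assms(1))
  also have "br (u t q) (u p s) = - (if s = t then u p q else 0)"
    using assms(3-) by (simp add: assms(2))
  also have "br (u t q) (u r t) = (if q = r then u t t else 0) - u r q"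
    using assms(3-) by (simp add: assms(2))
  finally show ?thesis by (simp split: if_splits)
qed

theorem br_unit:
  assumes "1 \<le> p" "p \<le> n" "1 \<le> q" "q \<le> n" "1 \<le> r" "r \<le> n" "1 \<le> s" "s \<le> n"
  shows "br (u p q) (u r s) = (if q = r then u p s else 0) - (if s = p then u r q else 0)"
  using assms
\<comment> \<open>The measure is the distance of \<open>p\<close> and \<open>q\<close>. Splitting
  off the index next to the larger of the two leaves units at smaller distance.\<close>
proof (induction "p + q - 2 * min p q" arbitrary: p q r s rule: less_induct)
  case less
  consider "p = q" | "q = Suc p" | "p = Suc q" | "Suc p < q" | "Suc q < p" by linarith
  then show ?case
  proof cases
    case 1 with weight_unit[of p r s] less.prems show ?thesis by auto
  next
    case 2 with br_E_unit[of r s p] less.prems show ?thesis by auto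
  next
    case 3 with br_F_unit[of r s q] less.prems show ?thesis by auto
  next
    case 4
    then have "u p q = br (u p (q - 1)) (u (q - 1) q)"
      using upper[of p "q - 1"] less.prems by simp
    moreover have "br (br (u p (q - 1)) (u (q - 1) q)) (u r s) =
        (if q = r then u p s else 0) - (if s = p then u r q else 0)"
    proof (rule br_unit_aux)
      fix r s assume rs: "1 \<le> r" "r \<le> n" "1 \<le> s" "s \<le> n"
      show "br (u p (q - 1)) (u r s) = (if q - 1 = r then u p s else 0) - (if s = p then u r (q - 1) else 0)"
        by (rule less.hyps) (use less.prems rs 4 in auto)
      show "br (u (q - 1) q) (u r s) = (if q = r then u (q - 1) s else 0) - (if s = q - 1 then u r q else 0)"
        by (rule less.hyps) (use less.prems rs 4 in auto)
    qed (use less.prems 4 in auto)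
    ultimately show ?thesis by simp
  next
    case 5
    then have "u p q = br (u p (p - 1)) (u (p - 1) q)"
      using lower[of q "p - 1"] less.prems by simp
    moreover have "br (br (u p (p - 1)) (u (p - 1) q)) (u r s) =
        (if q = r then u p s else 0) - (if s = p then u r q else 0)"
    proof (rule br_unit_aux)
      fix r s assume rs: "1 \<le> r" "r \<le> n" "1 \<le> s" "s \<le> n"
      show "br (u p (p - 1)) (u r s) = (if p - 1 = r then u p s else 0) - (if s = p then u r (p - 1) else 0)"
        by (rule less.hyps) (use less.prems rs 5 in auto)
      show "br (u (p - 1) q) (u r s) = (if q = r then u (p - 1) s else 0) - (if s = p - 1 then u r q else 0)"
        by (rule less.hyps) (use less.prems rs 5 in auto)
    qed (use less.prems 5 in auto)
    ultimately show ?thesis by simp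
  qed
qed

end

section \<open>Lagrange interpolation\<close>

text \<open>For distinct nodes this is the coefficient of 1 / (\<rho>_j - t) in the partial fraction
  expansion of the product of all (\<nu>_i - t) / (\<rho>_i - t).\<close>

definition lagrange_term :: "('i \<Rightarrow> 'a::field) \<Rightarrow> ('i \<Rightarrow> 'a) \<Rightarrow> 'i set \<Rightarrow> 'i \<Rightarrow> 'a" where
  "lagrange_term \<nu> \<rho> J j = (\<Prod>i\<in>J. \<nu> i - \<rho> j) / (\<Prod>i\<in>J - {j}. \<rho> i - \<rho> j)"

lemma lagrange_term_insert:
  assumes "finite J" "a \<notin> J"
  shows "j \<in> J \<Longrightarrow> lagrange_term \<nu> \<rho> (insert a J) j
      = lagrange_term \<nu> \<rho> J j * ((\<nu> a - \<rho> j) / (\<rho> a - \<rho> j))"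
    and "lagrange_term \<nu> \<rho> (insert a J) a = (\<nu> a - \<rho> a) * (\<Prod>i\<in>J. (\<nu> i - \<rho> a) / (\<rho> i - \<rho> a))"
proof -
  assume "j \<in> J"
  then have "insert a J - {j} = insert a (J - {j})" using assms by auto
  then show "lagrange_term \<nu> \<rho> (insert a J) j
      = lagrange_term \<nu> \<rho> J j * ((\<nu> a - \<rho> j) / (\<rho> a - \<rho> j))"
    using assms by (simp add: lagrange_term_def mult.commute)
next
  have "insert a J - {a} = J" using assms by auto
  then show "lagrange_term \<nu> \<rho> (insert a J) a = (\<nu> a - \<rho> a) * (\<Prod>i\<in>J. (\<nu> i - \<rho> a) / (\<rho> i - \<rho> a))"
    using assms by (simp add: lagrange_term_def prod_dividef)
qed

text \<open>A new index multiplies the expansion by 1 + (\<nu>_a - \<rho>_a) / (\<rho>_a - t).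
  Splitting the products of two poles leaves at the new pole the old product evaluated at \<rho>_a,
  which is why \<open>t\<close> stays arbitrary in the induction.\<close>

lemma partial_fractions:
  assumes "finite J" "inj_on \<rho> J" "t \<notin> \<rho> ` J"
  shows "(\<Prod>i\<in>J. (\<nu> i - t) / (\<rho> i - t)) = 1 + (\<Sum>j\<in>J. lagrange_term \<nu> \<rho> J j / (\<rho> j - t))"
  using assms
proof (induction J arbitrary: t rule: finite_induct)
  case (insert a J)
  define L where "L t = (\<Prod>i\<in>J. (\<nu> i - t) / (\<rho> i - t))" for t
  define T where "T = lagrange_term \<nu> \<rho> J"
  have inj: "inj_on \<rho> J" "\<rho> a \<notin> \<rho> ` J" using insert by auto
  have t: "t \<noteq> \<rho> a" "t \<notin> \<rho> ` J" using insert.prems by auto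
  have Lt: "L t = 1 + (\<Sum>j\<in>J. T j / (\<rho> j - t))" and La: "L (\<rho> a) = 1 + (\<Sum>j\<in>J. T j / (\<rho> j - \<rho> a))"
    unfolding L_def T_def using insert.IH inj t by blast+
  have split: "T j * ((\<nu> a - \<rho> j) / (\<rho> a - \<rho> j)) / (\<rho> j - t) =
      T j / (\<rho> j - t) + (\<nu> a - \<rho> a) / (\<rho> a - t) * (T j / (\<rho> j - t) - T j / (\<rho> j - \<rho> a))" if "j \<in> J" for j
  proof -
    have ne: "\<rho> a - \<rho> j \<noteq> 0" "\<rho> j - t \<noteq> 0" "\<rho> a - t \<noteq> 0" "\<rho> j - \<rho> a \<noteq> 0"
      using inj(2) t that by (auto simp: image_iff)
    have "(\<nu> a - \<rho> j) / (\<rho> a - \<rho> j) / (\<rho> j - t) =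
      1 / (\<rho> j - t) + (\<nu> a - \<rho> a) / (\<rho> a - t) * (1 / (\<rho> j - t) - 1 / (\<rho> j - \<rho> a))"
      using ne by (simp add: divide_simps) (simp add: algebra_simps)
    then have "T j * ((\<nu> a - \<rho> j) / (\<rho> a - \<rho> j) / (\<rho> j - t)) =
      T j * (1 / (\<rho> j - t) + (\<nu> a - \<rho> a) / (\<rho> a - t) * (1 / (\<rho> j - t) - 1 / (\<rho> j - \<rho> a)))"
      by simp
    then show ?thesis by (simp add: algebra_simps)
  qed
  have "(\<Sum>j\<in>insert a J. lagrange_term \<nu> \<rho> (insert a J) j / (\<rho> j - t)) =
      (\<nu> a - \<rho> a) * L (\<rho> a) / (\<rho> a - t) + (\<Sum>j\<in>J. T j * ((\<nu> a - \<rho> j) / (\<rho> a - \<rho> j)) / (\<rho> j - t))"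
    using insert.hyps by (simp add: lagrange_term_insert L_def T_def)
  also have "(\<Sum>j\<in>J. T j * ((\<nu> a - \<rho> j) / (\<rho> a - \<rho> j)) / (\<rho> j - t)) =
      (L t - 1) + (\<nu> a - \<rho> a) / (\<rho> a - t) * (L t - L (\<rho> a))"
    by (simp only: sum.cong[OF refl split] sum.distrib sum_distrib_left[symmetric] sum_subtractf)
      (simp add: Lt La)
  also have "1 + ((\<nu> a - \<rho> a) * L (\<rho> a) / (\<rho> a - t) +
      ((L t - 1) + (\<nu> a - \<rho> a) / (\<rho> a - t) * (L t - L (\<rho> a)))) = (\<nu> a - t) / (\<rho> a - t) * L t"
    using t(1) by (simp add: divide_simps) (simp add: algebra_simps)
  finally show ?case using insert.hyps by (simp add: L_def)
qed simp

text \<open>This compares the coefficients of 1/t at infinity in the partial fraction expansion. The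
  induction avoids limits: it uses the expansion only at \<rho>_a, where it evaluates the term of
  the new node.\<close>

lemma sum_lagrange_term_inj:
  assumes "finite J" "inj_on \<rho> J"
  shows "(\<Sum>j\<in>J. lagrange_term \<nu> \<rho> J j) = (\<Sum>j\<in>J. \<nu> j - \<rho> j)"
  using assms
proof (induction J rule: finite_induct)
  case (insert a J)
  define T where "T = lagrange_term \<nu> \<rho> J"
  have "inj_on \<rho> J" "\<rho> a \<notin> \<rho> ` J" using insert by auto
  have split: "T j * ((\<nu> a - \<rho> j) / (\<rho> a - \<rho> j)) = T j - (\<nu> a - \<rho> a) * (T j / (\<rho> j - \<rho> a))" if "j \<in> J" for j
  proof -
    have ne: "\<rho> a - \<rho> j \<noteq> 0" "\<rho> j - \<rho> a \<noteq> 0" using \<open>\<rho> a \<notin> \<rho> ` J\<close> that by (auto simp: image_iff)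
    then have *: "(\<nu> a - \<rho> j) / (\<rho> a - \<rho> j) = 1 - (\<nu> a - \<rho> a) / (\<rho> j - \<rho> a)"
      by (simp add: divide_simps) (simp add: algebra_simps)
    show ?thesis unfolding * by (simp add: algebra_simps)
  qed
  have "(\<Sum>j\<in>insert a J. lagrange_term \<nu> \<rho> (insert a J) j) =
      (\<nu> a - \<rho> a) * (1 + (\<Sum>j\<in>J. T j / (\<rho> j - \<rho> a))) + (\<Sum>j\<in>J. T j * ((\<nu> a - \<rho> j) / (\<rho> a - \<rho> j)))"
    using insert by (simp add: lagrange_term_insert T_def partial_fractions)
  also have "(\<Sum>j\<in>J. T j * ((\<nu> a - \<rho> j) / (\<rho> a - \<rho> j))) =
      (\<Sum>j\<in>J. \<nu> j - \<rho> j) - (\<nu> a - \<rho> a) * (\<Sum>j\<in>J. T j / (\<rho> j - \<rho> a))"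
    by (simp only: sum.cong[OF refl split] sum_distrib_left[symmetric] sum_subtractf)
      (use insert in \<open>simp add: T_def sum_subtractf\<close>)
  finally show ?case using insert.hyps by (simp add: algebra_simps)
qed simp

text \<open>Two nodes may coincide when both terms vanish: their denominators are then zero, and
  x / 0 = 0 gives the same value as deleting the two indices.\<close>

lemma sum_lagrange_term:
  assumes "finite J" and coincide: "\<And>i j. \<lbrakk>i \<in> J; j \<in> J; i \<noteq> j; \<rho> i = \<rho> j\<rbrakk> \<Longrightarrow> \<nu> i = \<rho> i"
  shows "(\<Sum>j\<in>J. lagrange_term \<nu> \<rho> J j) = (\<Sum>j\<in>J. \<nu> j - \<rho> j)"
proof -
  define K where "K = {j \<in> J. \<nu> j \<noteq> \<rho> j}"
  have fin: "finite K" and sub: "K \<subseteq> J" using assms(1) by (auto simp: K_def)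
  have "lagrange_term \<nu> \<rho> J j = 0" if "j \<in> J - K" for j
    using that assms(1) by (auto simp: lagrange_term_def K_def intro!: prod_zero)
  moreover have "lagrange_term \<nu> \<rho> J j = lagrange_term \<nu> \<rho> K j" if "j \<in> K" for j
  proof -
    define p where "p = (\<Prod>i\<in>J - K. \<rho> i - \<rho> j)"
    have "\<rho> i \<noteq> \<rho> j" if "i \<in> J - K" for i
      using that \<open>j \<in> K\<close> coincide[of j i] by (cases "i = j") (auto simp: K_def)
    then have "p \<noteq> 0" unfolding p_def using assms(1) by auto
    have J: "J = K \<union> (J - K)" "J - {j} = (K - {j}) \<union> (J - K)" using sub that by auto
    have "(\<Prod>i\<in>J. \<nu> i - \<rho> j) = (\<Prod>i\<in>K. \<nu> i - \<rho> j) * (\<Prod>i\<in>J - K. \<nu> i - \<rho> j)"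
      by (subst J(1), rule prod.union_disjoint) (use fin assms(1) in auto)
    moreover have "(\<Prod>i\<in>J - K. \<nu> i - \<rho> j) = p"
      unfolding p_def by (rule prod.cong) (auto simp: K_def)
    moreover have "(\<Prod>i\<in>J - {j}. \<rho> i - \<rho> j) = (\<Prod>i\<in>K - {j}. \<rho> i - \<rho> j) * p"
      unfolding p_def by (subst J(2), rule prod.union_disjoint) (use fin assms(1) in auto)
    ultimately show ?thesis using \<open>p \<noteq> 0\<close> by (simp add: lagrange_term_def)
  qed
  ultimately have "(\<Sum>j\<in>J. lagrange_term \<nu> \<rho> J j) = (\<Sum>j\<in>K. lagrange_term \<nu> \<rho> K j)"
    using assms(1) sub by (intro sum.mono_neutral_cong_right) auto
  also have "inj_on \<rho> K"
    using coincide unfolding inj_on_def K_def by blast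
  then have "(\<Sum>j\<in>K. lagrange_term \<nu> \<rho> K j) = (\<Sum>j\<in>K. \<nu> j - \<rho> j)"
    using fin by (intro sum_lagrange_term_inj)
  also have "\<dots> = (\<Sum>j\<in>J. \<nu> j - \<rho> j)"
    using assms(1) by (intro sum.mono_neutral_left) (auto simp: K_def)
  finally show ?thesis .
qed

section \<open>Gelfand--Tsetlin coefficients\<close>

text \<open>The radicand of the raising coefficient, indexed by the row \<open>r\<close> = k - 1
  that changes. Without the root, all identities below are rational.\<close>

definition gt_radicand :: "gt_array \<Rightarrow> nat \<Rightarrow> nat \<Rightarrow> real" where
  "gt_radicand \<xi> r j = - ((\<Prod>i = 1..Suc r. gt_l \<xi> i (Suc r) - gt_l \<xi> j r) *
      (\<Prod>i = 1..r - 1. gt_l \<xi> i (r - 1) - gt_l \<xi> j r - 1)) /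
     (\<Prod>i \<in> {1..r} - {j}. (gt_l \<xi> i r - gt_l \<xi> j r) * (gt_l \<xi> i r - gt_l \<xi> j r - 1))"

lemma gt_l_shift:
  "gt_l (gt_shift j k d \<xi>) p q = gt_l \<xi> p q + (if p = j \<and> q = k then real_of_int d else 0)"
  by (simp add: gt_l_def gt_shift_def)

lemma gt_a_eq: "gt_a \<xi> (Suc r) j = sqrt (gt_radicand \<xi> r j)"
  by (simp add: gt_a_def gt_radicand_def)

text \<open>Lowering from \<open>\<xi>\<close> has the coefficient of raising back to
  \<open>\<xi>\<close>. This makes F the transpose of E, and only \<open>gt_a\<close> needs
  study.\<close>

lemma gt_b_eq:
  assumes "1 \<le> r"
  shows "gt_b \<xi> (Suc r) j = gt_a (gt_shift j r (- 1) \<xi>) (Suc r) j"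
proof -
  let ?\<xi> = "gt_shift j r (- 1) \<xi>"
  \<comment> \<open>Subtraction is truncated, so for r = 0 the rows r - 1 and r would be the same
    row and the shift would affect both.\<close>
  have r: "Suc r - 2 = r - 1" "r - 1 \<noteq> r" "r \<noteq> r - 1" using assms by auto
  have D: "(\<Prod>i \<in> {1..r} - {j}. (gt_l \<xi> i r - gt_l \<xi> j r + 1) * (gt_l \<xi> i r - gt_l \<xi> j r)) =
    (\<Prod>i \<in> {1..r} - {j}. (gt_l ?\<xi> i r - gt_l ?\<xi> j r) * (gt_l ?\<xi> i r - gt_l ?\<xi> j r - 1))"
    by (intro prod.cong) (auto simp: gt_l_shift)
  have Y: "(\<Prod>i = 1..Suc r. gt_l \<xi> i (Suc r) - gt_l \<xi> j r + 1) =
    (\<Prod>i = 1..Suc r. gt_l ?\<xi> i (Suc r) - gt_l ?\<xi> j r)"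
    by (intro prod.cong) (auto simp: gt_l_shift)
  have Z: "(\<Prod>i = 1..r - 1. gt_l \<xi> i (r - 1) - gt_l \<xi> j r) =
    (\<Prod>i = 1..r - 1. gt_l ?\<xi> i (r - 1) - gt_l ?\<xi> j r - 1)"
    using r by (intro prod.cong) (auto simp: gt_l_shift)
  show ?thesis
    by (simp only: gt_a_def gt_b_def diff_Suc_1 r(1) D Y Z)
qed

text \<open>This and the next two lemmas isolate how a radicand depends on one other entry: two
  denominator factors for an entry of the same row, one numerator factor for an entry of a
  neighbouring row. The cofactors are untouched by the shift.\<close>

lemma gt_radicand_shift_same_row:
  assumes "1 \<le> i" "i \<le> r" "i \<noteq> j"
  obtains N D where "gt_radicand \<xi> r j = N / ((gt_l \<xi> i r - gt_l \<xi> j r) * (gt_l \<xi> i r - gt_l \<xi> j r - 1) * D)"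
    and "gt_radicand (gt_shift i r 1 \<xi>) r j = N / ((gt_l \<xi> i r - gt_l \<xi> j r + 1) * (gt_l \<xi> i r - gt_l \<xi> j r) * D)"
proof
  let ?N = "- ((\<Prod>i = 1..Suc r. gt_l \<xi> i (Suc r) - gt_l \<xi> j r) * (\<Prod>i = 1..r - 1. gt_l \<xi> i (r - 1) - gt_l \<xi> j r - 1))"
  let ?D = "\<lambda>\<xi>. \<Prod>p \<in> {1..r} - {j} - {i}. (gt_l \<xi> p r - gt_l \<xi> j r) * (gt_l \<xi> p r - gt_l \<xi> j r - 1)"
  have split: "(\<Prod>p \<in> {1..r} - {j}. (gt_l \<xi> p r - gt_l \<xi> j r) * (gt_l \<xi> p r - gt_l \<xi> j r - 1)) =
    (gt_l \<xi> i r - gt_l \<xi> j r) * (gt_l \<xi> i r - gt_l \<xi> j r - 1) * ?D \<xi>" for \<xi>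
    by (rule prod.remove) (use assms in auto)
  then show "gt_radicand \<xi> r j = ?N / ((gt_l \<xi> i r - gt_l \<xi> j r) * (gt_l \<xi> i r - gt_l \<xi> j r - 1) * ?D \<xi>)"
    by (simp only: gt_radicand_def)
  have "?D (gt_shift i r 1 \<xi>) = ?D \<xi>"
    by (intro prod.cong) (use assms in \<open>auto simp: gt_l_shift\<close>)
  moreover have "r - 1 \<noteq> r" using assms by simp
  ultimately show "gt_radicand (gt_shift i r 1 \<xi>) r j = ?N / ((gt_l \<xi> i r - gt_l \<xi> j r + 1) * (gt_l \<xi> i r - gt_l \<xi> j r) * ?D \<xi>)"
    unfolding gt_radicand_def split using assms by (simp add: gt_l_shift algebra_simps)
qed

lemma gt_radicand_shift_upper_row:
  assumes "1 \<le> i" "i \<le> Suc r"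
  obtains K where "gt_radicand \<xi> r j = (gt_l \<xi> i (Suc r) - gt_l \<xi> j r) * K"
    and "gt_radicand (gt_shift i (Suc r) 1 \<xi>) r j = (gt_l \<xi> i (Suc r) + 1 - gt_l \<xi> j r) * K"
proof
  let ?Y = "\<lambda>\<xi>. \<Prod>p \<in> {1..Suc r} - {i}. gt_l \<xi> p (Suc r) - gt_l \<xi> j r"
  let ?K = "- (?Y \<xi> * (\<Prod>i = 1..r - 1. gt_l \<xi> i (r - 1) - gt_l \<xi> j r - 1)) /
     (\<Prod>i \<in> {1..r} - {j}. (gt_l \<xi> i r - gt_l \<xi> j r) * (gt_l \<xi> i r - gt_l \<xi> j r - 1))"
  have split: "(\<Prod>p = 1..Suc r. gt_l \<xi> p (Suc r) - gt_l \<xi> j r) = (gt_l \<xi> i (Suc r) - gt_l \<xi> j r) * ?Y \<xi>" for \<xi>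
    by (rule prod.remove) (use assms in auto)
  show "gt_radicand \<xi> r j = (gt_l \<xi> i (Suc r) - gt_l \<xi> j r) * ?K"
    unfolding gt_radicand_def split by simp
  have "?Y (gt_shift i (Suc r) 1 \<xi>) = ?Y \<xi>"
    by (intro prod.cong) (auto simp: gt_l_shift)
  moreover have "r - 1 \<noteq> Suc r" by simp
  ultimately show "gt_radicand (gt_shift i (Suc r) 1 \<xi>) r j = (gt_l \<xi> i (Suc r) + 1 - gt_l \<xi> j r) * ?K"
    unfolding gt_radicand_def split by (simp add: gt_l_shift)
qed

lemma gt_radicand_shift_lower_row:
  assumes "1 \<le> j" "j \<le> r"
  obtains K where "gt_radicand \<xi> (Suc r) i = (gt_l \<xi> j r - gt_l \<xi> i (Suc r) - 1) * K"
    and "gt_radicand (gt_shift j r 1 \<xi>) (Suc r) i = (gt_l \<xi> j r - gt_l \<xi> i (Suc r)) * K"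
proof
  let ?Z = "\<lambda>\<xi>. \<Prod>p \<in> {1..r} - {j}. gt_l \<xi> p r - gt_l \<xi> i (Suc r) - 1"
  let ?K = "- ((\<Prod>p = 1..Suc (Suc r). gt_l \<xi> p (Suc (Suc r)) - gt_l \<xi> i (Suc r)) * ?Z \<xi>) /
     (\<Prod>p \<in> {1..Suc r} - {i}. (gt_l \<xi> p (Suc r) - gt_l \<xi> i (Suc r)) * (gt_l \<xi> p (Suc r) - gt_l \<xi> i (Suc r) - 1))"
  have split: "(\<Prod>p = 1..Suc r - 1. gt_l \<xi> p (Suc r - 1) - gt_l \<xi> i (Suc r) - 1) = (gt_l \<xi> j r - gt_l \<xi> i (Suc r) - 1) * ?Z \<xi>" for \<xi>
    unfolding diff_Suc_1 by (rule prod.remove) (use assms in auto)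
  show "gt_radicand \<xi> (Suc r) i = (gt_l \<xi> j r - gt_l \<xi> i (Suc r) - 1) * ?K"
    unfolding gt_radicand_def split by simp
  have "?Z (gt_shift j r 1 \<xi>) = ?Z \<xi>"
    by (intro prod.cong) (auto simp: gt_l_shift)
  then show "gt_radicand (gt_shift j r 1 \<xi>) (Suc r) i = (gt_l \<xi> j r - gt_l \<xi> i (Suc r)) * ?K"
    unfolding gt_radicand_def split by (simp add: gt_l_shift)
qed

lemma gt_radicand_shift_far:
  assumes "s \<noteq> r - 1" "s \<noteq> r" "s \<noteq> Suc r"
  shows "gt_radicand (gt_shift i s d \<xi>) r j = gt_radicand \<xi> r j"
  using assms[symmetric] by (simp add: gt_radicand_def gt_l_shift)

text \<open>Two raises at different places may be done in either order. For neighbouring rows, with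
  e the difference of the two entries of \<open>gt_l\<close>, both sides contain the factor -e(e +
  1); rows further apart do not interact.\<close>

lemma gt_radicand_exchange_le:
  assumes "r \<le> s" "1 \<le> j" "j \<le> r" "1 \<le> i" "i \<le> s" "(j, r) \<noteq> (i, s)"
  shows "gt_radicand \<xi> r j * gt_radicand \<xi> s i =
    gt_radicand (gt_shift i s 1 \<xi>) r j * gt_radicand (gt_shift j r 1 \<xi>) s i"
proof -
  consider "r = s" "i \<noteq> j" | "s = Suc r" | "Suc r < s" using assms by fastforce
  then show ?thesis
  proof cases
    case 1
    define d where "d = gt_l \<xi> i r - gt_l \<xi> j r"
    have d: "gt_l \<xi> j r - gt_l \<xi> i r = - d" by (simp add: d_def)
    obtain N D where j: "gt_radicand \<xi> r j = N / (d * (d - 1) * D)"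
      "gt_radicand (gt_shift i r 1 \<xi>) r j = N / ((d + 1) * d * D)"
      using gt_radicand_shift_same_row[of i r j \<xi>] 1 assms unfolding d_def by blast
    obtain N' D' where i: "gt_radicand \<xi> r i = N' / (- d * (- d - 1) * D')"
      "gt_radicand (gt_shift j r 1 \<xi>) r i = N' / ((- d + 1) * - d * D')"
      using gt_radicand_shift_same_row[of j r i \<xi>] 1 assms unfolding d by blast
    \<comment> \<open>Both sides have the same product of denominators, so the quotients agree even
      if that product is 0.\<close>
    have "(d * (d - 1) * D) * (- d * (- d - 1) * D') = ((d + 1) * d * D) * ((- d + 1) * - d * D')"
      by (simp add: algebra_simps)
    then show ?thesis unfolding 1(1)[symmetric] i j by (simp only: times_divide_times_eq)
  next
    case 2
    obtain K where K: "gt_radicand \<xi> r j = (gt_l \<xi> i s - gt_l \<xi> j r) * K"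
      "gt_radicand (gt_shift i s 1 \<xi>) r j = (gt_l \<xi> i s + 1 - gt_l \<xi> j r) * K"
      using gt_radicand_shift_upper_row[of i r \<xi> j] 2 assms by blast
    obtain K' where K': "gt_radicand \<xi> s i = (gt_l \<xi> j r - gt_l \<xi> i s - 1) * K'"
      "gt_radicand (gt_shift j r 1 \<xi>) s i = (gt_l \<xi> j r - gt_l \<xi> i s) * K'"
      using gt_radicand_shift_lower_row[of j r \<xi> i] 2 assms by blast
    show ?thesis unfolding K K' by (simp add: algebra_simps)
  next
    case 3
    then show ?thesis by (simp add: gt_radicand_shift_far)
  qed
qed

lemma gt_radicand_exchange:
  assumes "1 \<le> j" "j \<le> r" "1 \<le> i" "i \<le> s" "(j, r) \<noteq> (i, s)"
  shows "gt_radicand \<xi> r j * gt_radicand \<xi> s i =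
    gt_radicand (gt_shift i s 1 \<xi>) r j * gt_radicand (gt_shift j r 1 \<xi>) s i"
proof (cases "r \<le> s")
  case True
  with assms show ?thesis by (intro gt_radicand_exchange_le)
next
  case False
  with assms gt_radicand_exchange_le[of s r i j \<xi>] show ?thesis by (auto simp: mult.commute)
qed

text \<open>\<open>sqrt\<close> is odd, hence multiplicative on all reals, so passing to the roots
  requires no sign of a radicand.\<close>

lemma gt_a_exchange:
  assumes "1 \<le> j" "j \<le> r" "1 \<le> i" "i \<le> s" "(j, r) \<noteq> (i, s)"
  shows "gt_a \<xi> (Suc r) j * gt_a \<xi> (Suc s) i =
    gt_a (gt_shift i s 1 \<xi>) (Suc r) j * gt_a (gt_shift j r 1 \<xi>) (Suc s) i"
  unfolding gt_a_eq real_sqrt_mult[symmetric] gt_radicand_exchange[OF assms] ..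

lemma sum_gt_radicand:
  assumes "1 \<le> r" and interlace: "\<And>i. \<lbrakk>1 \<le> i; i \<le> r\<rbrakk> \<Longrightarrow> \<xi> i (Suc r) \<ge> \<xi> i r \<and> \<xi> i r \<ge> \<xi> (Suc i) (Suc r)"
    "\<And>i. \<lbrakk>1 \<le> i; i < r\<rbrakk> \<Longrightarrow> \<xi> i r \<ge> \<xi> i (r - 1) \<and> \<xi> i (r - 1) \<ge> \<xi> (Suc i) r"
  shows "(\<Sum>j = 1..r. gt_radicand (gt_shift j r (- 1) \<xi>) r j - gt_radicand \<xi> r j) =
    real_of_int (2 * (\<Sum>i = 1..r. \<xi> i r) - (\<Sum>i = 1..Suc r. \<xi> i (Suc r)) - (\<Sum>i = 1..r - 1. \<xi> i (r - 1)))"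
proof -
  define x y z where "x i = gt_l \<xi> i r" and "y i = gt_l \<xi> i (Suc r)" and "z i = gt_l \<xi> i (r - 1)" for i
  \<comment> \<open>The nodes are the x_j and the x_j - 1, the Lagrange terms at which are the radicands of the
    coefficients of the pattern and of the pattern lowered at j; equal adjacent entries of row r
    make two nodes coincide, and interlacing then forces the numerators to vanish.\<close>
  define \<nu> \<rho> where "\<nu> = case_sum y (\<lambda>i. if i = r then y (Suc r) else z i - 1)"
    and "\<rho> = case_sum x (\<lambda>i. x i - 1)"
  define J :: "(nat + nat) set" where "J = {1..r} <+> {1..r}"
  have split_last: "{1..r} = insert r {1..r - 1}" using assms(1) by auto
  have antitone: "x i > x j" if "1 \<le> i" "i < j" "j \<le> r" for i j
    using Suc_leI[OF that(2)] that(3)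
  proof (induction j rule: dec_induct)
    case base with interlace(2)[of i] that show ?case by (simp add: x_def gt_l_def)
  next
    case (step k)
    with interlace(2)[of k] that show ?case by (simp add: x_def gt_l_def)
  qed
  have prod_\<nu>: "(\<Prod>i\<in>J. \<nu> i - t) = (\<Prod>i = 1..Suc r. y i - t) * (\<Prod>i = 1..r - 1. z i - t - 1)" for t
  proof -
    have "(\<Prod>i\<in>J. \<nu> i - t) = (\<Prod>i = 1..r. y i - t) * (\<Prod>i = 1..r. (if i = r then y (Suc r) else z i - 1) - t)"
      by (simp add: J_def prod.Plus \<nu>_def)
    also have "(\<Prod>i = 1..r. (if i = r then y (Suc r) else z i - 1) - t) =
        (y (Suc r) - t) * (\<Prod>i = 1..r - 1. z i - t - 1)"
      using assms(1) unfolding split_last by (subst prod.insert) (auto intro!: prod.cong)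
    finally show ?thesis by simp
  qed
  have left: "lagrange_term \<nu> \<rho> J (Inl j) = gt_radicand \<xi> r j" if "1 \<le> j" "j \<le> r" for j
  proof -
    have "J - {Inl j} = ({1..r} - {j}) <+> {1..r}" by (auto simp: J_def)
    then have "(\<Prod>i\<in>J - {Inl j}. \<rho> i - \<rho> (Inl j)) = (\<Prod>i\<in>{1..r} - {j}. x i - x j) * (\<Prod>i = 1..r. x i - x j - 1)"
      by (simp add: prod.Plus \<rho>_def diff_diff_eq add.commute)
    \<comment> \<open>The factor with i = j is -1; it becomes the minus sign in the
      radicand.\<close>
    also have "(\<Prod>i = 1..r. x i - x j - 1) = - (\<Prod>i\<in>{1..r} - {j}. x i - x j - 1)"
      using that by (subst prod.remove[of _ j]) auto
    finally have den: "(\<Prod>i\<in>J - {Inl j}. \<rho> i - \<rho> (Inl j)) =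
        - (\<Prod>i\<in>{1..r} - {j}. (x i - x j) * (x i - x j - 1))"
      by (simp add: prod.distrib)
    have "\<rho> (Inl j) = x j" by (simp add: \<rho>_def)
    then show ?thesis
      unfolding lagrange_term_def prod_\<nu> gt_radicand_def den
      unfolding x_def y_def z_def by simp
  qed
  have right: "lagrange_term \<nu> \<rho> J (Inr j) = - gt_radicand (gt_shift j r (- 1) \<xi>) r j" if "1 \<le> j" "j \<le> r" for j
  proof -
    have "J - {Inr j} = {1..r} <+> ({1..r} - {j})" by (auto simp: J_def)
    then have "(\<Prod>i\<in>J - {Inr j}. \<rho> i - \<rho> (Inr j)) = (\<Prod>i = 1..r. x i - (x j - 1)) * (\<Prod>i\<in>{1..r} - {j}. x i - x j)"
      by (simp add: prod.Plus \<rho>_def)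
    \<comment> \<open>Here the factor with i = j is 1, so the term is the radicand with the opposite
      sign.\<close>
    also have "(\<Prod>i = 1..r. x i - (x j - 1)) = (\<Prod>i\<in>{1..r} - {j}. x i - (x j - 1))"
      using that by (subst prod.remove[of _ j]) auto
    also have "\<dots> * (\<Prod>i\<in>{1..r} - {j}. x i - x j) =
        (\<Prod>i\<in>{1..r} - {j}. (x i - (x j - 1)) * (x i - (x j - 1) - 1))"
      by (simp add: prod.distrib)
    also have "\<dots> = (\<Prod>i\<in>{1..r} - {j}. (gt_l (gt_shift j r (- 1) \<xi>) i r - gt_l (gt_shift j r (- 1) \<xi>) j r) *
        (gt_l (gt_shift j r (- 1) \<xi>) i r - gt_l (gt_shift j r (- 1) \<xi>) j r - 1))"
      by (intro prod.cong) (auto simp: gt_l_shift x_def)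
    finally have den: "(\<Prod>i\<in>J - {Inr j}. \<rho> i - \<rho> (Inr j)) = \<dots>" .
    have Y: "(\<Prod>i = 1..Suc r. y i - \<rho> (Inr j)) =
        (\<Prod>i = 1..Suc r. gt_l (gt_shift j r (- 1) \<xi>) i (Suc r) - gt_l (gt_shift j r (- 1) \<xi>) j r)"
      by (intro prod.cong) (auto simp: gt_l_shift x_def y_def \<rho>_def)
    have Z: "(\<Prod>i = 1..r - 1. z i - \<rho> (Inr j) - 1) =
        (\<Prod>i = 1..r - 1. gt_l (gt_shift j r (- 1) \<xi>) i (r - 1) - gt_l (gt_shift j r (- 1) \<xi>) j r - 1)"
      using assms(1) by (intro prod.cong) (auto simp: gt_l_shift x_def z_def \<rho>_def)
    show ?thesis
      by (simp only: lagrange_term_def prod_\<nu> gt_radicand_def den Y Z minus_divide_left minus_minus)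
  qed
  have coincide: "\<nu> i = \<rho> i" if "i \<in> J" "j \<in> J" "i \<noteq> j" "\<rho> i = \<rho> j" for i j
  proof -
    have *: "\<nu> (Inl p) = \<rho> (Inl p) \<and> \<nu> (Inr q) = \<rho> (Inr q)"
      if "1 \<le> p" "p \<le> r" "1 \<le> q" "q \<le> r" "\<rho> (Inl p) = \<rho> (Inr q)" for p q
    proof -
      have eq: "x p = x q - 1" using that by (simp add: \<rho>_def)
      have "q < p" using eq antitone[of p q] that by (cases p q rule: linorder_cases) auto
      \<comment> \<open>Otherwise x_{q+1} would lie strictly between x_p and x_p + 1, although all
        these numbers are integers.\<close>
      moreover have "\<not> Suc q < p"
      proof
        assume "Suc q < p"
        then have "x q > x (Suc q)" "x (Suc q) > x p" using antitone that by auto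
        then have "real_of_int (\<xi> q r - int q) > real_of_int (\<xi> (Suc q) r - int (Suc q))"
          "real_of_int (\<xi> (Suc q) r - int (Suc q)) > real_of_int (\<xi> p r - int p)"
          "real_of_int (\<xi> p r - int p) = real_of_int (\<xi> q r - int q - 1)"
          using eq by (simp_all add: x_def gt_l_def)
        then show False unfolding of_int_less_iff of_int_eq_iff by linarith
      qed
      ultimately have p: "p = Suc q" by simp
      then have "\<xi> (Suc q) r = \<xi> q r" using eq by (simp add: x_def gt_l_def)
      then show ?thesis using interlace(1)[of q] interlace(2)[of q] interlace(1)[of p] p that
        by (auto simp: \<nu>_def \<rho>_def x_def y_def z_def gt_l_def)
    qed
    have inj: "x p = x q \<Longrightarrow> p = q" if "1 \<le> p" "p \<le> r" "1 \<le> q" "q \<le> r" for p q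
      using antitone[of p q] antitone[of q p] that by (cases p q rule: linorder_cases) auto
    show ?thesis
    proof (cases i; cases j)
      fix p q assume ij: "i = Inl p" "j = Inl q"
      then show ?thesis using that inj by (auto simp: J_def \<rho>_def)
    next
      fix p q assume ij: "i = Inl p" "j = Inr q"
      then show ?thesis using that *[of p q] by (auto simp: J_def)
    next
      fix p q assume ij: "i = Inr p" "j = Inl q"
      then show ?thesis using that *[of q p] by (auto simp: J_def)
    next
      fix p q assume ij: "i = Inr p" "j = Inr q"
      then show ?thesis using that inj by (auto simp: J_def \<rho>_def)
    qed
  qed
  have "(\<Sum>j\<in>J. lagrange_term \<nu> \<rho> J j) =
      (\<Sum>j = 1..r. lagrange_term \<nu> \<rho> J (Inl j)) + (\<Sum>j = 1..r. lagrange_term \<nu> \<rho> J (Inr j))"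
    by (simp add: J_def sum.Plus)
  also have "\<dots> = (\<Sum>j = 1..r. gt_radicand \<xi> r j) + (\<Sum>j = 1..r. - gt_radicand (gt_shift j r (- 1) \<xi>) r j)"
    by (intro arg_cong2[of _ _ _ _ "(+)"] sum.cong) (auto simp: left right)
  finally have "(\<Sum>j = 1..r. gt_radicand (gt_shift j r (- 1) \<xi>) r j - gt_radicand \<xi> r j) =
      - (\<Sum>j\<in>J. lagrange_term \<nu> \<rho> J j)"
    by (simp add: sum_subtractf sum_negf)
  also have "(\<Sum>j\<in>J. lagrange_term \<nu> \<rho> J j) = (\<Sum>j\<in>J. \<nu> j - \<rho> j)"
    using coincide by (intro sum_lagrange_term) (auto simp: J_def)
  also have "\<dots> = (\<Sum>i = 1..r. y i - x i) + (\<Sum>i = 1..r. (if i = r then y (Suc r) else z i - 1) - (x i - 1))"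
    by (simp add: J_def sum.Plus \<nu>_def \<rho>_def)
  \<comment> \<open>Slot \<open>r\<close> pairs y_{r+1} with x_r - 1; the surplus 1 cancels against
    the offsets r + 1 and r inside \<open>gt_l\<close>.\<close>
  also have "(\<Sum>i = 1..r. (if i = r then y (Suc r) else z i - 1) - (x i - 1)) =
      (y (Suc r) - (x r - 1)) + (\<Sum>i = 1..r - 1. z i - x i)"
    using assms(1) unfolding split_last by (subst sum.insert) (auto intro!: sum.cong)
  also have "(\<Sum>i = 1..r. y i - x i) = real_of_int ((\<Sum>i = 1..r. \<xi> i (Suc r)) - (\<Sum>i = 1..r. \<xi> i r))"
    by (simp add: x_def y_def gt_l_def sum_subtractf)
  also have "(\<Sum>i = 1..r - 1. z i - x i) = real_of_int ((\<Sum>i = 1..r - 1. \<xi> i (r - 1)) - (\<Sum>i = 1..r - 1. \<xi> i r))"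
    by (simp add: x_def z_def gt_l_def sum_subtractf)
  also have "(\<Sum>i = 1..r - 1. \<xi> i r) = (\<Sum>i = 1..r. \<xi> i r) - \<xi> r r"
    unfolding split_last using assms(1) by (subst sum.insert) auto
  finally show ?thesis by (simp add: x_def y_def gt_l_def)
qed

section \<open>Interlacing and the neighbours of a pattern\<close>

lemma gt_pattern_interlace:
  assumes "\<xi> \<in> gt_patterns n m" "1 \<le> i" "i \<le> r" "r < n"
  shows "\<xi> i (Suc r) \<ge> \<xi> i r" "\<xi> i r \<ge> \<xi> (Suc i) (Suc r)"
proof -
  have "Suc r \<in> {2..n}" "i \<in> {1..Suc r - 1}" using assms by auto
  with assms(1) show "\<xi> i (Suc r) \<ge> \<xi> i r" "\<xi> i r \<ge> \<xi> (Suc i) (Suc r)"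
    unfolding gt_patterns_def by fastforce+
qed

lemma gt_pattern_interlace':
  assumes "\<xi> \<in> gt_patterns n m" "1 \<le> i" "i < r" "r \<le> n"
  shows "\<xi> i r \<ge> \<xi> i (r - 1)" "\<xi> i (r - 1) \<ge> \<xi> (Suc i) r"
  using gt_pattern_interlace[of \<xi> n m i "r - 1"] assms by auto

lemma gt_pattern_top_row: "\<lbrakk>\<xi> \<in> gt_patterns n m; 1 \<le> i; i \<le> n\<rbrakk> \<Longrightarrow> \<xi> i n = m i"
  by (auto simp: gt_patterns_def)

lemma gt_pattern_antitone:
  assumes "\<xi> \<in> gt_patterns n m" "1 \<le> i" "i \<le> i'" "i' \<le> k" "k \<le> n"
  shows "\<xi> i' k \<le> \<xi> i k"
  using assms(3,4)
proof (induction i' rule: dec_induct)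
  case (step p)
  with gt_pattern_interlace'[of \<xi> n m p k] assms show ?case by auto
qed simp

lemma gt_patternI:
  assumes "\<And>i k. \<not> (1 \<le> i \<and> i \<le> k \<and> k \<le> n) \<Longrightarrow> \<xi> i k = 0"
    and "\<And>i. \<lbrakk>1 \<le> i; i \<le> n\<rbrakk> \<Longrightarrow> \<xi> i n = m i"
    and "\<And>i r. \<lbrakk>1 \<le> i; i \<le> r; r < n\<rbrakk> \<Longrightarrow> \<xi> i (Suc r) \<ge> \<xi> i r \<and> \<xi> i r \<ge> \<xi> (Suc i) (Suc r)"
  shows "\<xi> \<in> gt_patterns n m"
proof -
  have "\<xi> i k \<ge> \<xi> i (k - 1) \<and> \<xi> i (k - 1) \<ge> \<xi> (i + 1) k" if "k \<in> {2..n}" "i \<in> {1..k - 1}" for i k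
  proof -
    have "Suc (k - 1) = k" "1 \<le> i" "i \<le> k - 1" "k - 1 < n" using that by auto
    with assms(3)[of i "k - 1"] show ?thesis by simp
  qed
  with assms(1,2) show ?thesis by (auto simp: gt_patterns_def)
qed

lemma gt_pattern_outside: "\<lbrakk>\<xi> \<in> gt_patterns n m; \<not> (1 \<le> i \<and> i \<le> k \<and> k \<le> n)\<rbrakk> \<Longrightarrow> \<xi> i k = 0"
  unfolding gt_patterns_def by blast

lemma gt_shift_apply: "gt_shift j r d \<xi> i k = (if i = j \<and> k = r then \<xi> i k + d else \<xi> i k)"
  by (simp add: gt_shift_def)

lemma gt_shift_zero [simp]: "gt_shift j r 0 \<xi> = \<xi>"
  by (simp add: gt_shift_def)

lemma gt_shift_same [simp]: "gt_shift j r d (gt_shift j r e \<xi>) = gt_shift j r (e + d) \<xi>"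
  by (intro ext) (simp add: gt_shift_apply)

lemma gt_shift_commute: "gt_shift j r d (gt_shift i s e \<xi>) = gt_shift i s e (gt_shift j r d \<xi>)"
  by (intro ext) (simp add: gt_shift_apply)

text \<open>The zeros outside the triangle and the fixed top row leave only the entries of rows
  below \<open>n\<close> free to move.\<close>

lemma gt_shift_pattern_range:
  assumes "\<xi> \<in> gt_patterns n m" "gt_shift j r d \<xi> \<in> gt_patterns n m" "d \<noteq> 0"
  shows "1 \<le> j" "j \<le> r" "r < n"
proof -
  have ne: "gt_shift j r d \<xi> j r \<noteq> \<xi> j r" using assms(3) by (simp add: gt_shift_apply)
  then have *: "1 \<le> j \<and> j \<le> r \<and> r \<le> n"
    using gt_pattern_outside[OF assms(1), of j r] gt_pattern_outside[OF assms(2), of j r] by fastforce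
  moreover have "r \<noteq> n"
    using ne * gt_pattern_top_row[OF assms(1), of j] gt_pattern_top_row[OF assms(2), of j] by auto
  ultimately show "1 \<le> j" "j \<le> r" "r < n" by auto
qed

text \<open>Of the neighbouring entries only two bound an entry from above, and the one in row r - 1
  exists only for j \<ge> 2. For lowering, the bound from row r - 1 exists only for j < r.\<close>

lemma gt_shift_up_mem:
  assumes "\<xi> \<in> gt_patterns n m" "1 \<le> j" "j \<le> r" "r < n" "\<xi> j r < \<xi> j (Suc r)"
    and "2 \<le> j \<Longrightarrow> \<xi> j r < \<xi> (j - 1) (r - 1)"
  shows "gt_shift j r 1 \<xi> \<in> gt_patterns n m"
proof (rule gt_patternI)
  fix i k assume "\<not> (1 \<le> i \<and> i \<le> k \<and> k \<le> n)"
  with gt_pattern_outside[OF assms(1), of i k] assms show "gt_shift j r 1 \<xi> i k = 0"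
    by (auto simp: gt_shift_apply)
next
  fix i assume "1 \<le> i" "i \<le> n"
  with gt_pattern_top_row[OF assms(1), of i] assms show "gt_shift j r 1 \<xi> i n = m i"
    by (auto simp: gt_shift_apply)
next
  fix i k assume "1 \<le> i" "i \<le> k" "k < n"
  with gt_pattern_interlace[OF assms(1), of i k] assms(4-)
  show "gt_shift j r 1 \<xi> i (Suc k) \<ge> gt_shift j r 1 \<xi> i k \<and> gt_shift j r 1 \<xi> i k \<ge> gt_shift j r 1 \<xi> (Suc i) (Suc k)"
    by (auto simp: gt_shift_apply)
qed

lemma gt_shift_down_mem:
  assumes "\<xi> \<in> gt_patterns n m" "1 \<le> j" "j \<le> r" "r < n" "\<xi> (Suc j) (Suc r) < \<xi> j r"
    and "j < r \<Longrightarrow> \<xi> j (r - 1) < \<xi> j r"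
  shows "gt_shift j r (- 1) \<xi> \<in> gt_patterns n m"
proof (rule gt_patternI)
  fix i k assume "\<not> (1 \<le> i \<and> i \<le> k \<and> k \<le> n)"
  with gt_pattern_outside[OF assms(1), of i k] assms show "gt_shift j r (- 1) \<xi> i k = 0"
    by (auto simp: gt_shift_apply)
next
  fix i assume "1 \<le> i" "i \<le> n"
  with gt_pattern_top_row[OF assms(1), of i] assms show "gt_shift j r (- 1) \<xi> i n = m i"
    by (auto simp: gt_shift_apply)
next
  fix i k assume "1 \<le> i" "i \<le> k" "k < n"
  with gt_pattern_interlace[OF assms(1), of i k] assms(4-)
  show "gt_shift j r (- 1) \<xi> i (Suc k) \<ge> gt_shift j r (- 1) \<xi> i k \<and>
      gt_shift j r (- 1) \<xi> i k \<ge> gt_shift j r (- 1) \<xi> (Suc i) (Suc k)"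
    by (auto simp: gt_shift_apply)
qed

text \<open>The other two corners of the square are the pointwise minimum and maximum of the given
  ones, and patterns are closed under both.\<close>

lemma gt_shift_square_mem:
  assumes "gt_shift j r 1 \<xi> \<in> gt_patterns n m" "gt_shift i s 1 \<xi> \<in> gt_patterns n m" "(j, r) \<noteq> (i, s)"
  shows "\<xi> \<in> gt_patterns n m" "gt_shift i s 1 (gt_shift j r 1 \<xi>) \<in> gt_patterns n m"
proof -
  let ?\<alpha> = "gt_shift j r 1 \<xi>" and ?\<beta> = "gt_shift i s 1 \<xi>"
  have "(\<lambda>p k. min (?\<alpha> p k) (?\<beta> p k)) \<in> gt_patterns n m"
  proof (rule gt_patternI)
    fix p k assume "1 \<le> p" "p \<le> k" "k < n"
    then show "min (?\<alpha> p (Suc k)) (?\<beta> p (Suc k)) \<ge> min (?\<alpha> p k) (?\<beta> p k) \<and>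
        min (?\<alpha> p k) (?\<beta> p k) \<ge> min (?\<alpha> (Suc p) (Suc k)) (?\<beta> (Suc p) (Suc k))"
      using gt_pattern_interlace[OF assms(1), of p k] gt_pattern_interlace[OF assms(2), of p k]
      by (auto simp: min_def)
  qed (simp_all add: gt_pattern_outside[OF assms(1)] gt_pattern_outside[OF assms(2)]
      gt_pattern_top_row[OF assms(1)] gt_pattern_top_row[OF assms(2)])
  moreover have "(\<lambda>p k. min (?\<alpha> p k) (?\<beta> p k)) = \<xi>"
    using assms(3) by (intro ext) (auto simp: gt_shift_apply)
  ultimately show "\<xi> \<in> gt_patterns n m" by simp
  have "(\<lambda>p k. max (?\<alpha> p k) (?\<beta> p k)) \<in> gt_patterns n m"
  proof (rule gt_patternI)
    fix p k assume "1 \<le> p" "p \<le> k" "k < n"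
    then show "max (?\<alpha> p (Suc k)) (?\<beta> p (Suc k)) \<ge> max (?\<alpha> p k) (?\<beta> p k) \<and>
        max (?\<alpha> p k) (?\<beta> p k) \<ge> max (?\<alpha> (Suc p) (Suc k)) (?\<beta> (Suc p) (Suc k))"
      using gt_pattern_interlace[OF assms(1), of p k] gt_pattern_interlace[OF assms(2), of p k]
      by (auto simp: max_def)
  qed (simp_all add: gt_pattern_outside[OF assms(1)] gt_pattern_outside[OF assms(2)]
      gt_pattern_top_row[OF assms(1)] gt_pattern_top_row[OF assms(2)])
  moreover have "(\<lambda>p k. max (?\<alpha> p k) (?\<beta> p k)) = gt_shift i s 1 ?\<alpha>"
    using assms(3) by (intro ext) (auto simp: gt_shift_apply)
  ultimately show "gt_shift i s 1 ?\<alpha> \<in> gt_patterns n m" by simp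
qed

lemma prod_negative:
  fixes f :: "'i \<Rightarrow> real"
  assumes "\<And>i. i \<in> A \<Longrightarrow> f i < 0"
  shows "(- 1) ^ card A * prod f A > 0"
proof (cases "finite A")
  case True
  have "(- 1) ^ card A * prod f A = (\<Prod>i\<in>A. - f i)"
    by (simp add: prod_uminus)
  also have "\<dots> > 0" using assms by (intro prod_pos) auto
  finally show ?thesis .
qed simp

text \<open>Interlacing fixes all signs. The negative numerator factors are the r + 1 - j from the
  row above with i > j and the r - j from the row below with i \<ge> j, an odd number in all, which
  the leading minus sign compensates. The two factors of each pair in the denominator have equal
  signs. Strictness for the entries bounding row \<open>r\<close> at \<open>j\<close> from above
  comes from the raised array being a pattern.\<close>

lemma gt_radicand_pos:
  assumes "\<xi> \<in> gt_patterns n m" "gt_shift j r 1 \<xi> \<in> gt_patterns n m"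
  shows "gt_radicand \<xi> r j > 0"
proof -
  note range = gt_shift_pattern_range[OF assms, simplified]
  have r: "r - 1 \<noteq> r" "Suc (r - 1) = r" using range by auto
  have pos_less: "real_of_int a - real_of_int b > 0" if "b < a" for a b :: int using that by simp
  define y where "y i = gt_l \<xi> i (Suc r) - gt_l \<xi> j r" for i
  define z where "z i = gt_l \<xi> i (r - 1) - gt_l \<xi> j r - 1" for i
  define x where "x i = (gt_l \<xi> i r - gt_l \<xi> j r) * (gt_l \<xi> i r - gt_l \<xi> j r - 1)" for i
  have upper: "\<xi> j r + 1 \<le> \<xi> j (Suc r)"
    using gt_pattern_interlace(1)[OF assms(2), of j r] range by (simp add: gt_shift_apply)
  have ypos: "y i > 0" if "1 \<le> i" "i \<le> j" for i
  proof -
    have "\<xi> j r - int j < \<xi> i (Suc r) - int i"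
      using upper gt_pattern_antitone[OF assms(1), of i j "Suc r"] range that by simp
    then show ?thesis unfolding y_def gt_l_def by (rule pos_less)
  qed
  have yneg: "y i < 0" if "j < i" "i \<le> Suc r" for i
  proof -
    have "\<xi> i (Suc r) - int i < \<xi> j r - int j"
      using gt_pattern_interlace(2)[OF assms(1), of j r] gt_pattern_antitone[OF assms(1), of "Suc j" i "Suc r"] range that
      by simp
    then show ?thesis unfolding y_def gt_l_def using pos_less by fastforce
  qed
  have zpos: "z i > 0" if "1 \<le> i" "i < j" for i
  proof -
    have "\<xi> (j - 1) (r - 1) \<ge> \<xi> j r + 1"
      using gt_pattern_interlace(2)[OF assms(2), of "j - 1" "r - 1"] range that r by (simp add: gt_shift_apply)
    moreover have "\<xi> i (r - 1) \<ge> \<xi> (j - 1) (r - 1)"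
      using gt_pattern_antitone[OF assms(1), of i "j - 1" "r - 1"] range that by simp
    ultimately have "\<xi> j r - int j + 1 < \<xi> i (r - 1) - int i" using that by simp
    from pos_less[OF this] show ?thesis unfolding z_def gt_l_def by simp
  qed
  have zneg: "z i < 0" if "j \<le> i" "i \<le> r - 1" for i
  proof -
    have "\<xi> j (r - 1) \<le> \<xi> j r"
      using gt_pattern_interlace(1)[OF assms(1), of j "r - 1"] range that r by simp
    moreover have "\<xi> i (r - 1) \<le> \<xi> j (r - 1)"
      using gt_pattern_antitone[OF assms(1), of j i "r - 1"] range that by simp
    ultimately have "\<xi> i (r - 1) - int i < \<xi> j r - int j + 1" using that by simp
    from pos_less[OF this] show ?thesis unfolding z_def gt_l_def by simp
  qed
  have xpos: "x i > 0" if "i \<in> {1..r} - {j}" for i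
  proof (cases "i < j")
    case True
    then have "\<xi> j r - int j + 1 < \<xi> i r - int i"
      using gt_pattern_antitone[OF assms(2), of i j r] range that by (simp add: gt_shift_apply)
    from pos_less[OF this] show ?thesis unfolding x_def gt_l_def by (intro mult_pos_pos) simp_all
  next
    case False
    then have "\<xi> i r - int i < \<xi> j r - int j"
      using gt_pattern_antitone[OF assms(1), of j i r] range that by simp
    from pos_less[OF this] show ?thesis unfolding x_def gt_l_def by (intro mult_neg_neg) simp_all
  qed
  have "{1..Suc r} = {1..j} \<union> {Suc j..Suc r}" using range by auto
  then have Y: "prod y {1..Suc r} = prod y {1..j} * prod y {Suc j..Suc r}"
    by (simp only:) (rule prod.union_disjoint, auto)
  have "{1..r - 1} = {1..<j} \<union> {j..r - 1}" using range by auto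
  then have Z: "prod z {1..r - 1} = prod z {1..<j} * prod z {j..r - 1}"
    by (simp only:) (rule prod.union_disjoint, auto)
  have Y0: "(- 1) ^ (Suc r - j) * prod y {Suc j..Suc r} > 0"
    using prod_negative[of "{Suc j..Suc r}" y] yneg by simp
  have Z0: "(- 1) ^ (r - j) * prod z {j..r - 1} > 0"
    using prod_negative[of "{j..r - 1}" z] zneg r by simp
  have P: "prod y {1..j} > 0" "prod z {1..<j} > 0"
    using ypos zpos by (auto intro!: prod_pos)
  have "(prod y {1..j} * prod z {1..<j}) *
      (((- 1) ^ (Suc r - j) * prod y {Suc j..Suc r}) * ((- 1) ^ (r - j) * prod z {j..r - 1})) > 0"
    by (rule mult_pos_pos[OF mult_pos_pos[OF P] mult_pos_pos[OF Y0 Z0]])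
  also have "(- 1) ^ (Suc r - j) = - ((- 1) ^ (r - j) :: real)"
    using range by (simp add: Suc_diff_le)
  finally have "- (prod y {1..Suc r} * prod z {1..r - 1}) > 0"
    by (simp only: Y Z) (simp add: algebra_simps flip: power_mult_distrib power_add)
  moreover have "prod x ({1..r} - {j}) > 0"
    using xpos by (intro prod_pos) auto
  ultimately show ?thesis
    unfolding gt_radicand_def y_def z_def x_def by (rule divide_pos_pos)
qed

text \<open>The extension by 0 turns the restricted sums in E and F into sums over all j, and lets
  the exchange identity hold for every array.\<close>

definition gt_coeff :: "nat \<Rightarrow> (nat \<Rightarrow> int) \<Rightarrow> nat \<Rightarrow> nat \<Rightarrow> gt_array \<Rightarrow> real" where
  "gt_coeff n m r j \<xi> =
    (if \<xi> \<in> gt_patterns n m \<and> gt_shift j r 1 \<xi> \<in> gt_patterns n m then gt_a \<xi> (Suc r) j else 0)"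

text \<open>If the product on either side is nonzero, both single raises are patterns, and then so
  are all four corners of the square.\<close>

lemma gt_coeff_exchange:
  assumes "(j, r) \<noteq> (i, s)"
  shows "gt_coeff n m r j \<xi> * gt_coeff n m s i \<xi> =
    gt_coeff n m r j (gt_shift i s 1 \<xi>) * gt_coeff n m s i (gt_shift j r 1 \<xi>)"
proof (cases "gt_shift j r 1 \<xi> \<in> gt_patterns n m \<and> gt_shift i s 1 \<xi> \<in> gt_patterns n m")
  case True
  then have mem: "\<xi> \<in> gt_patterns n m" "gt_shift i s 1 (gt_shift j r 1 \<xi>) \<in> gt_patterns n m"
    using gt_shift_square_mem assms by blast+
  have "1 \<le> j" "j \<le> r" "1 \<le> i" "i \<le> s"
    using gt_shift_pattern_range[OF mem(1), of j r 1] gt_shift_pattern_range[OF mem(1), of i s 1] True by auto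
  from gt_a_exchange[OF this assms] show ?thesis
    using True mem gt_shift_commute[of i s 1 j r 1 \<xi>] by (simp add: gt_coeff_def)
next
  case False
  then show ?thesis by (auto simp: gt_coeff_def)
qed

text \<open>When raising leads out of the patterns, the numerator of the radicand has a zero factor, so
  that the radicand is 0 even if its denominator vanishes as well.\<close>

lemma gt_coeff_square:
  assumes "\<xi> \<in> gt_patterns n m" "1 \<le> j" "j \<le> r" "r < n"
  shows "(gt_coeff n m r j \<xi>)\<^sup>2 = gt_radicand \<xi> r j"
proof (cases "gt_shift j r 1 \<xi> \<in> gt_patterns n m")
  case True
  with assms gt_radicand_pos[of \<xi> n m j r] show ?thesis by (simp add: gt_coeff_def gt_a_eq)
next
  case False
  then consider "\<xi> j r = \<xi> j (Suc r)" | "2 \<le> j" "\<xi> j r = \<xi> (j - 1) (r - 1)"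
    using gt_shift_up_mem[OF assms] gt_pattern_interlace(1)[OF assms]
      gt_pattern_interlace(2)[OF assms(1), of "j - 1" "r - 1"] assms by force
  then have "gt_radicand \<xi> r j = 0"
  proof cases
    case 1
    then have "(\<Prod>i = 1..Suc r. gt_l \<xi> i (Suc r) - gt_l \<xi> j r) = 0"
      using assms by (intro prod_zero) (auto intro!: bexI[of _ j] simp: gt_l_def)
    then show ?thesis by (simp only: gt_radicand_def mult_zero_left mult_zero_right minus_zero div_0)
  next
    case 2
    then have "(\<Prod>i = 1..r - 1. gt_l \<xi> i (r - 1) - gt_l \<xi> j r - 1) = 0"
      using assms by (intro prod_zero) (auto intro!: bexI[of _ "j - 1"] simp: gt_l_def of_nat_diff)
    then show ?thesis by (simp only: gt_radicand_def mult_zero_left mult_zero_right minus_zero div_0)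
  qed
  with False show ?thesis by (simp add: gt_coeff_def)
qed

text \<open>The lowered array may fail to be a pattern, so \<open>gt_coeff_square\<close> does not
  apply to it directly; again the entry blocking the move gives a zero factor in the
  numerator.\<close>

lemma gt_coeff_down_square:
  assumes "\<xi> \<in> gt_patterns n m" "1 \<le> j" "j \<le> r" "r < n"
  shows "(gt_coeff n m r j (gt_shift j r (- 1) \<xi>))\<^sup>2 = gt_radicand (gt_shift j r (- 1) \<xi>) r j"
proof (cases "gt_shift j r (- 1) \<xi> \<in> gt_patterns n m")
  case True
  with assms show ?thesis by (intro gt_coeff_square)
next
  case False
  have r: "r - 1 \<noteq> r" "r \<noteq> r - 1" using assms by auto
  from False consider "\<xi> j r = \<xi> (Suc j) (Suc r)" | "j < r" "\<xi> j r = \<xi> j (r - 1)"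
    using gt_shift_down_mem[OF assms] gt_pattern_interlace(2)[OF assms]
      gt_pattern_interlace'(1)[OF assms(1), of j r] assms by force
  then have "gt_radicand (gt_shift j r (- 1) \<xi>) r j = 0"
  proof cases
    case 1
    then have "(\<Prod>i = 1..Suc r. gt_l (gt_shift j r (- 1) \<xi>) i (Suc r) - gt_l (gt_shift j r (- 1) \<xi>) j r) = 0"
      using assms by (intro prod_zero) (auto intro!: bexI[of _ "Suc j"] simp: gt_l_def gt_shift_apply)
    then show ?thesis by (simp only: gt_radicand_def mult_zero_left mult_zero_right minus_zero div_0)
  next
    case 2
    then have "(\<Prod>i = 1..r - 1. gt_l (gt_shift j r (- 1) \<xi>) i (r - 1) - gt_l (gt_shift j r (- 1) \<xi>) j r - 1) = 0"
      using assms r by (intro prod_zero) (auto intro!: bexI[of _ j] simp: gt_l_def gt_shift_apply)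
    then show ?thesis by (simp only: gt_radicand_def mult_zero_left mult_zero_right minus_zero div_0)
  qed
  with False show ?thesis by (simp add: gt_coeff_def)
qed

text \<open>The left-hand side is the diagonal entry of [E_r, F_r] at \<open>\<xi>\<close>, the
  right-hand side the eigenvalue of H_r - H_{r+1}.\<close>

lemma sum_gt_coeff_squares:
  assumes "\<xi> \<in> gt_patterns n m" "1 \<le> r" "r < n"
  shows "(\<Sum>j = 1..r. (gt_coeff n m r j (gt_shift j r (- 1) \<xi>))\<^sup>2 - (gt_coeff n m r j \<xi>)\<^sup>2) =
    real_of_int (2 * (\<Sum>i = 1..r. \<xi> i r) - (\<Sum>i = 1..Suc r. \<xi> i (Suc r)) - (\<Sum>i = 1..r - 1. \<xi> i (r - 1)))"
proof -
  have "(\<Sum>j = 1..r. (gt_coeff n m r j (gt_shift j r (- 1) \<xi>))\<^sup>2 - (gt_coeff n m r j \<xi>)\<^sup>2) =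
    (\<Sum>j = 1..r. gt_radicand (gt_shift j r (- 1) \<xi>) r j - gt_radicand \<xi> r j)"
    using assms by (intro sum.cong) (auto simp: gt_coeff_square gt_coeff_down_square)
  also have "\<dots> = real_of_int (2 * (\<Sum>i = 1..r. \<xi> i r) - (\<Sum>i = 1..Suc r. \<xi> i (Suc r)) - (\<Sum>i = 1..r - 1. \<xi> i (r - 1)))"
    by (rule sum_gt_radicand) (use assms gt_pattern_interlace gt_pattern_interlace' in auto)
  finally show ?thesis .
qed

lemma gt_pattern_bounds:
  assumes "\<xi> \<in> gt_patterns n m" "1 \<le> i" "i \<le> k" "k \<le> n"
  shows "\<xi> i k \<le> m 1" "m n \<le> \<xi> i k"
proof -
  have "\<xi> i k \<le> m 1 \<and> m n \<le> \<xi> i k" using assms(4,2,3)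
  proof (induction k arbitrary: i rule: inc_induct)
    case base
    with assms(1) show ?case
      using gt_pattern_antitone[OF assms(1), of 1 i n] gt_pattern_antitone[OF assms(1), of i n n]
        gt_pattern_top_row[OF assms(1), of 1] gt_pattern_top_row[OF assms(1), of n] by auto
  next
    case (step k)
    have "\<xi> i (Suc k) \<le> m 1" "m n \<le> \<xi> (Suc i) (Suc k)"
      using step.IH[of i] step.IH[of "Suc i"] step.prems by auto
    with gt_pattern_interlace[OF assms(1), of i k] step.hyps step.prems show ?case by linarith
  qed
  then show "\<xi> i k \<le> m 1" "m n \<le> \<xi> i k" by auto
qed

lemma finite_gt_patterns [simp]: "finite (gt_patterns n m)"
proof -
  define F where "F = {f :: nat \<times> nat \<Rightarrow> int. \<forall>x. (x \<in> {..n} \<times> {..n} \<longrightarrow> f x \<in> insert 0 {m n..m 1}) \<and>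
      (x \<notin> {..n} \<times> {..n} \<longrightarrow> f x = 0)}"
  have "finite F" unfolding F_def by (rule finite_set_of_finite_funs) auto
  moreover have "gt_patterns n m \<subseteq> curry ` F"
  proof
    fix \<xi> assume \<xi>: "\<xi> \<in> gt_patterns n m"
    have "\<xi> a b \<in> insert 0 {m n..m 1}" for a b
      using gt_pattern_bounds[OF \<xi>, of a b] gt_pattern_outside[OF \<xi>, of a b]
      by (cases "1 \<le> a \<and> a \<le> b \<and> b \<le> n") auto
    moreover have "\<xi> a b = 0" if "\<not> (a \<le> n \<and> b \<le> n)" for a b
      using that by (intro gt_pattern_outside[OF \<xi>]) auto
    ultimately have "case_prod \<xi> \<in> F" unfolding F_def by auto
    then show "\<xi> \<in> curry ` F" by (rule rev_image_eqI) simp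
  qed
  ultimately show ?thesis by (rule finite_surj)
qed


section \<open>The Gelfand--Tsetlin operators\<close>

lemma sum_fun_apply: "(\<Sum>x\<in>A. f x) y = (\<Sum>x\<in>A. f x y)"
  by (induction A rule: infinite_finite_induct) auto

text \<open>The coordinate form: \<open>\<eta>\<close> receives contributions from the arrays one
  raise below it. It holds for every function \<open>v\<close> and every array, which permits
  computing on the whole function space instead of \<open>gt_space\<close>.\<close>

lemma gt_E_apply:
  "gt_E n m (Suc r) v \<eta> =
    (\<Sum>j = 1..r. complex_of_real (gt_coeff n m r j (gt_shift j r (- 1) \<eta>)) * v (gt_shift j r (- 1) \<eta>))"
proof -
  let ?P = "gt_patterns n m"
  have set_eq: "{j \<in> {1..Suc r - 1}. Q j} = {1..r} \<inter> {j. Q j}" for Q by auto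
  have inner: "(\<Sum>\<xi>\<in>?P. (if gt_shift j r 1 \<xi> \<in> ?P then v \<xi> * (gt_a \<xi> (Suc r) j * gt_basis (gt_shift j r 1 \<xi>) \<eta>) else 0)) =
     complex_of_real (gt_coeff n m r j (gt_shift j r (- 1) \<eta>)) * v (gt_shift j r (- 1) \<eta>)" (is "?l = _") for j
  proof -
    have eq: "\<eta> = gt_shift j r 1 \<xi> \<longleftrightarrow> gt_shift j r (- 1) \<eta> = \<xi>" for \<xi>
      by (metis gt_shift_same gt_shift_zero add.right_inverse add.left_inverse)
    have "?l = (\<Sum>\<xi>\<in>?P. if gt_shift j r (- 1) \<eta> = \<xi> then
        (if gt_shift j r 1 \<xi> \<in> ?P then v \<xi> * complex_of_real (gt_a \<xi> (Suc r) j) else 0) else 0)"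
      by (intro sum.cong) (auto simp: gt_basis_def eq)
    then show ?thesis by (simp add: gt_coeff_def)
  qed
  have "gt_E n m (Suc r) v \<eta> = (\<Sum>\<xi>\<in>?P. \<Sum>j\<in>{1..r} \<inter> {j. gt_shift j r 1 \<xi> \<in> ?P}.
      v \<xi> * (gt_a \<xi> (Suc r) j * gt_basis (gt_shift j r 1 \<xi>) \<eta>))"
    unfolding gt_E_def set_eq by (simp add: gt_extend_def gt_scale_def sum_fun_apply sum_distrib_left)
  also have "\<dots> = (\<Sum>\<xi>\<in>?P. \<Sum>j = 1..r. (if gt_shift j r 1 \<xi> \<in> ?P then
      v \<xi> * (gt_a \<xi> (Suc r) j * gt_basis (gt_shift j r 1 \<xi>) \<eta>) else 0))"
    by (simp add: sum.inter_restrict)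
  finally show ?thesis by (subst (asm) sum.swap) (simp only: inner)
qed

lemma gt_F_apply:
  assumes "1 \<le> r"
  shows "gt_F n m (Suc r) v \<eta> =
    (\<Sum>j = 1..r. complex_of_real (gt_coeff n m r j \<eta>) * v (gt_shift j r 1 \<eta>))"
proof -
  let ?P = "gt_patterns n m"
  have set_eq: "{j \<in> {1..Suc r - 1}. Q j} = {1..r} \<inter> {j. Q j}" for Q by auto
  have inner: "(\<Sum>\<xi>\<in>?P. (if gt_shift j r (- 1) \<xi> \<in> ?P then v \<xi> * (gt_b \<xi> (Suc r) j * gt_basis (gt_shift j r (- 1) \<xi>) \<eta>) else 0)) =
     complex_of_real (gt_coeff n m r j \<eta>) * v (gt_shift j r 1 \<eta>)" (is "?l = _") for j
  proof -
    have eq: "\<eta> = gt_shift j r (- 1) \<xi> \<longleftrightarrow> gt_shift j r 1 \<eta> = \<xi>" for \<xi>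
      by (metis gt_shift_same gt_shift_zero add.right_inverse add.left_inverse)
    have "?l = (\<Sum>\<xi>\<in>?P. if gt_shift j r 1 \<eta> = \<xi> then
        (if gt_shift j r (- 1) \<xi> \<in> ?P then v \<xi> * complex_of_real (gt_b \<xi> (Suc r) j) else 0) else 0)"
      by (intro sum.cong) (auto simp: gt_basis_def eq)
    then show ?thesis using assms by (simp add: gt_coeff_def gt_b_eq)
  qed
  have "gt_F n m (Suc r) v \<eta> = (\<Sum>\<xi>\<in>?P. \<Sum>j\<in>{1..r} \<inter> {j. gt_shift j r (- 1) \<xi> \<in> ?P}.
      v \<xi> * (gt_b \<xi> (Suc r) j * gt_basis (gt_shift j r (- 1) \<xi>) \<eta>))"
    unfolding gt_F_def set_eq by (simp add: gt_extend_def gt_scale_def sum_fun_apply sum_distrib_left)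
  also have "\<dots> = (\<Sum>\<xi>\<in>?P. \<Sum>j = 1..r. (if gt_shift j r (- 1) \<xi> \<in> ?P then
      v \<xi> * (gt_b \<xi> (Suc r) j * gt_basis (gt_shift j r (- 1) \<xi>) \<eta>) else 0))"
    by (simp add: sum.inter_restrict)
  finally show ?thesis by (subst (asm) sum.swap) (simp only: inner)
qed

definition gt_weight :: "nat \<Rightarrow> gt_array \<Rightarrow> int" where
  "gt_weight k \<xi> = (\<Sum>i = 1..k. \<xi> i k) - (\<Sum>i = 1..k - 1. \<xi> i (k - 1))"

lemma gt_H_apply:
  "gt_H n m k v \<eta> = (if \<eta> \<in> gt_patterns n m then of_int (gt_weight k \<eta>) * v \<eta> else 0)"
proof -
  have "gt_H n m k v \<eta> = (\<Sum>\<xi>\<in>gt_patterns n m. if \<eta> = \<xi> then of_int (gt_weight k \<xi>) * v \<xi> else 0)"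
    unfolding gt_H_def gt_extend_def sum_fun_apply gt_weight_def[symmetric]
    by (intro sum.cong) (auto simp: gt_scale_def gt_basis_def)
  then show ?thesis by simp
qed

lemma gt_weight_shift:
  assumes "1 \<le> j" "j \<le> r" "1 \<le> k"
  shows "gt_weight k (gt_shift j r d \<xi>) = gt_weight k \<xi> + (of_bool (k = r) - of_bool (k = Suc r)) * d"
proof -
  have row: "(\<Sum>i = 1..p. gt_shift j r d \<xi> i p) = (\<Sum>i = 1..p. \<xi> i p) + of_bool (p = r) * d" for p
  proof (cases "p = r")
    case True
    have "(\<Sum>i = 1..r. gt_shift j r d \<xi> i r) = (\<Sum>i = 1..r. \<xi> i r + (if i = j then d else 0))"
      by (intro sum.cong) (auto simp: gt_shift_apply)
    with assms True show ?thesis by (simp add: sum.distrib)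
  qed (simp add: gt_shift_apply)
  have "k - 1 = r \<longleftrightarrow> k = Suc r" using assms by auto
  then show ?thesis unfolding gt_weight_def row by (simp add: algebra_simps)
qed

text \<open>Linear endomorphisms form a ring, which makes the commutator calculus available.\<close>

typedef gt_operator = "{f :: gt_vec \<Rightarrow> gt_vec.
    (\<forall>v w. f (v + w) = f v + f w) \<and> (\<forall>c v. f (gt_scale c v) = gt_scale c (f v))}"
  morphisms app_op Abs_op
  by (rule exI[of _ id]) simp

setup_lifting type_definition_gt_operator

instantiation gt_operator :: ring_1
begin

lift_definition zero_gt_operator :: gt_operator is "\<lambda>_. 0" by (auto simp: gt_scale_def)
lift_definition one_gt_operator :: gt_operator is "\<lambda>v. v" by simp
lift_definition plus_gt_operator :: "gt_operator \<Rightarrow> gt_operator \<Rightarrow> gt_operator" is "\<lambda>f g v. f v + g v"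
  by (auto simp: gt_scale_def algebra_simps)
lift_definition minus_gt_operator :: "gt_operator \<Rightarrow> gt_operator \<Rightarrow> gt_operator" is "\<lambda>f g v. f v - g v"
  by (auto simp: gt_scale_def algebra_simps)
lift_definition uminus_gt_operator :: "gt_operator \<Rightarrow> gt_operator" is "\<lambda>f v. - f v"
  by (auto simp: gt_scale_def algebra_simps)
lift_definition times_gt_operator :: "gt_operator \<Rightarrow> gt_operator \<Rightarrow> gt_operator" is "\<lambda>f g v. f (g v)"
  by auto

instance
proof
  show "(0::gt_operator) \<noteq> 1"
    by transfer (auto simp: fun_eq_iff intro!: exI[of _ "\<lambda>_. 1"])
qed (transfer; auto simp: algebra_simps)+

end

lemma app_op_simps [simp]:
  "app_op 0 v = 0" "app_op 1 v = v" "app_op (f + g) v = app_op f v + app_op g v"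
  "app_op (f - g) v = app_op f v - app_op g v" "app_op (- f) v = - app_op f v"
  "app_op (f * g) v = app_op f (app_op g v)"
  by (transfer; simp)+

lemma app_op_add: "app_op f (v + w) = app_op f v + app_op f w"
  and app_op_scale: "app_op f (gt_scale c v) = gt_scale c (app_op f v)"
  by (transfer; blast)+

lemma app_op_of_int: "app_op (of_int c * f) v = gt_scale (of_int c) (app_op f v)"
proof -
  have "app_op (of_nat k) w = gt_scale (of_nat k) w" for k w
    by (induction k) (auto simp: gt_scale_def algebra_simps)
  then have "app_op (of_int c) w = gt_scale (of_int c) w" for w
    by (cases c rule: int_cases2) (auto simp: gt_scale_def)
  then show ?thesis by simp
qed

lemma gt_operator_eqI: "(\<And>v \<eta>. app_op f v \<eta> = app_op g v \<eta>) \<Longrightarrow> f = g"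
  by (rule app_op_inject[THEN iffD1]) (intro ext)

lemma gt_operator_torsion_free: "of_nat (Suc k) * (f :: gt_operator) = 0 \<Longrightarrow> f = 0"
proof (rule gt_operator_eqI)
  fix v \<eta> assume "of_nat (Suc k) * f = 0"
  then have "gt_scale (of_nat (Suc k)) (app_op f v) \<eta> = 0"
    using app_op_of_int[of "int (Suc k)" f v] by simp
  then show "app_op f v \<eta> = app_op 0 v \<eta>" by (auto simp: gt_scale_def simp del: of_nat_Suc)
qed

lemma gt_extend_linear:
  "gt_extend n m T (v + w) = gt_extend n m T v + gt_extend n m T w"
  "gt_extend n m T (gt_scale c v) = gt_scale c (gt_extend n m T v)"
  by (auto simp: gt_extend_def gt_scale_def sum_fun_apply sum.distrib sum_distrib_left algebra_simps fun_eq_iff)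

text \<open>\<open>Abs_op\<close> has its intended value only on linear maps;
  \<open>gt_linear_unit\<close> provides linearity along the recursion of
  \<open>gt_unit\<close>.\<close>

definition unit_op :: "nat \<Rightarrow> (nat \<Rightarrow> int) \<Rightarrow> nat \<Rightarrow> nat \<Rightarrow> gt_operator" where
  "unit_op n m p q = Abs_op (if p = q then gt_H n m p else gt_unit n m p q)"

definition gt_linear :: "(gt_vec \<Rightarrow> gt_vec) \<Rightarrow> bool" where
  "gt_linear f \<longleftrightarrow> (\<forall>v w. f (v + w) = f v + f w) \<and> (\<forall>c v. f (gt_scale c v) = gt_scale c (f v))"

lemma gt_linear_commutator:
  assumes "gt_linear S" "gt_linear T"
  shows "gt_linear (commutator_op S T)"
proof -
  have "gt_scale c (v - w) = gt_scale c v - gt_scale c w" for c v w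
    by (auto simp: gt_scale_def algebra_simps)
  with assms show ?thesis by (simp add: gt_linear_def commutator_op_def)
qed

lemma gt_linear_unit: "gt_linear (gt_unit n m p q)"
proof (induction n m p q rule: gt_unit.induct)
  case (1 n m p q)
  have "gt_linear (gt_E n m k)" "gt_linear (gt_F n m k)" "gt_linear (\<lambda>v. 0)" for k
    by (auto simp: gt_linear_def gt_E_def gt_F_def gt_extend_linear) (auto simp: gt_scale_def)
  with 1 show ?case
    unfolding gt_unit.simps[of n m p q] by (simp add: gt_linear_commutator)
qed

lemma app_unit_op: "app_op (unit_op n m p q) = (if p = q then gt_H n m p else gt_unit n m p q)"
  unfolding unit_op_def
  by (rule Abs_op_inverse) (use gt_linear_unit in \<open>auto simp: gt_linear_def gt_H_def gt_extend_linear\<close>)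


lemma app_E: "app_op (unit_op n m r (Suc r)) = gt_E n m (Suc r)"
  by (simp add: app_unit_op gt_unit.simps[of n m r "Suc r"])

lemma app_F: "app_op (unit_op n m (Suc r) r) = gt_F n m (Suc r)"
  by (simp add: app_unit_op gt_unit.simps[of n m "Suc r" r])

lemma app_H: "app_op (unit_op n m k k) = gt_H n m k"
  by (simp add: app_unit_op)

lemma gt_coeff_nonpattern:
  "\<xi> \<notin> gt_patterns n m \<Longrightarrow> gt_coeff n m r j \<xi> = 0"
  "gt_shift j r 1 \<xi> \<notin> gt_patterns n m \<Longrightarrow> gt_coeff n m r j \<xi> = 0"
  by (auto simp: gt_coeff_def)

lemma gt_E_outside: "\<eta> \<notin> gt_patterns n m \<Longrightarrow> gt_E n m (Suc r) v \<eta> = 0"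
  by (simp add: gt_E_apply gt_coeff_nonpattern)

lemma gt_F_outside: "\<lbrakk>1 \<le> r; \<eta> \<notin> gt_patterns n m\<rbrakk> \<Longrightarrow> gt_F n m (Suc r) v \<eta> = 0"
  by (simp add: gt_F_apply gt_coeff_nonpattern)

section \<open>Brackets of the Gelfand-Tsetlin generators\<close>

lemma br_unit_op_H_E:
  assumes "1 \<le> i" "i < n" "1 \<le> k" "k \<le> n"
  shows "br (unit_op n m k k) (unit_op n m i (Suc i)) =
    of_int (of_bool (k = i) - of_bool (k = Suc i)) * unit_op n m i (Suc i)"
proof (rule gt_operator_eqI)
  fix v \<eta>
  let ?d = "of_bool (k = i) - of_bool (k = Suc i) :: int"
  show "app_op (br (unit_op n m k k) (unit_op n m i (Suc i))) v \<eta> =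
    app_op (of_int ?d * unit_op n m i (Suc i)) v \<eta>"
  proof (cases "\<eta> \<in> gt_patterns n m")
    case True
    let ?s = "\<lambda>j. gt_shift j i (- 1) \<eta>"
    have *: "of_int (gt_weight k \<eta>) * (complex_of_real (gt_coeff n m i j (?s j)) * v (?s j)) -
        complex_of_real (gt_coeff n m i j (?s j)) * gt_H n m k v (?s j) =
        of_int ?d * (complex_of_real (gt_coeff n m i j (?s j)) * v (?s j))" if "j \<in> {1..i}" for j
    proof (cases "?s j \<in> gt_patterns n m")
      case True
      have weight: "gt_weight k \<eta> = gt_weight k (?s j) + ?d"
        using gt_weight_shift[of j i k "- 1" \<eta>] that assms by simp
      have ring: "(W + D) * (c * x) - c * (W * x) = D * (c * x)" for W D c x :: complex
        by (simp add: algebra_simps)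
      show ?thesis using True by (simp only: gt_H_apply weight if_True of_int_add ring)
    qed (simp add: gt_coeff_nonpattern)
    have "app_op (br (unit_op n m k k) (unit_op n m i (Suc i))) v \<eta> =
        (\<Sum>j = 1..i. of_int (gt_weight k \<eta>) * (complex_of_real (gt_coeff n m i j (?s j)) * v (?s j)) -
        complex_of_real (gt_coeff n m i j (?s j)) * gt_H n m k v (?s j))"
      using True by (simp add: br_def app_E app_H gt_H_apply[of n m k "gt_E n m (Suc i) v"] gt_E_apply
          sum_distrib_left sum_subtractf)
    also have "\<dots> = (\<Sum>j = 1..i. of_int ?d * (complex_of_real (gt_coeff n m i j (?s j)) * v (?s j)))"
      by (rule sum.cong[OF refl *])
    finally show ?thesis
      by (simp only: app_op_of_int gt_scale_def app_E gt_E_apply sum_distrib_left)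
  next
    case False
    then show ?thesis
      by (simp add: br_def app_E app_H gt_E_outside gt_H_apply app_op_of_int gt_scale_def del: of_int_diff)
  qed
qed

lemma br_unit_op_H_F:
  assumes "1 \<le> i" "i < n" "1 \<le> k" "k \<le> n"
  shows "br (unit_op n m k k) (unit_op n m (Suc i) i) =
    of_int (of_bool (k = Suc i) - of_bool (k = i)) * unit_op n m (Suc i) i"
proof (rule gt_operator_eqI)
  fix v \<eta>
  let ?d = "of_bool (k = Suc i) - of_bool (k = i) :: int"
  show "app_op (br (unit_op n m k k) (unit_op n m (Suc i) i)) v \<eta> =
    app_op (of_int ?d * unit_op n m (Suc i) i) v \<eta>"
  proof (cases "\<eta> \<in> gt_patterns n m")
    case True
    let ?s = "\<lambda>j. gt_shift j i 1 \<eta>"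
    have *: "of_int (gt_weight k \<eta>) * (complex_of_real (gt_coeff n m i j \<eta>) * v (?s j)) -
        complex_of_real (gt_coeff n m i j \<eta>) * gt_H n m k v (?s j) =
        of_int ?d * (complex_of_real (gt_coeff n m i j \<eta>) * v (?s j))" if "j \<in> {1..i}" for j
    proof (cases "?s j \<in> gt_patterns n m")
      case True
      have weight: "gt_weight k \<eta> = gt_weight k (?s j) + ?d"
        using gt_weight_shift[of j i k "1" \<eta>] that assms by simp
      have ring: "(W + D) * (c * x) - c * (W * x) = D * (c * x)" for W D c x :: complex
        by (simp add: algebra_simps)
      show ?thesis using True by (simp only: gt_H_apply weight if_True of_int_add ring)
    qed (simp add: gt_coeff_nonpattern)
    have "app_op (br (unit_op n m k k) (unit_op n m (Suc i) i)) v \<eta> =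
        (\<Sum>j = 1..i. of_int (gt_weight k \<eta>) * (complex_of_real (gt_coeff n m i j \<eta>) * v (?s j)) -
        complex_of_real (gt_coeff n m i j \<eta>) * gt_H n m k v (?s j))"
      using True assms by (simp add: br_def app_F app_H gt_H_apply[of n m k "gt_F n m (Suc i) v"] gt_F_apply
          sum_distrib_left sum_subtractf)
    also have "\<dots> = (\<Sum>j = 1..i. of_int ?d * (complex_of_real (gt_coeff n m i j \<eta>) * v (?s j)))"
      by (rule sum.cong[OF refl *])
    finally show ?thesis
      by (simp only: app_op_of_int gt_scale_def app_F gt_F_apply[OF assms(1)] sum_distrib_left)
  next
    case False
    then show ?thesis using assms
      by (simp add: br_def app_F app_H gt_F_outside gt_H_apply app_op_of_int gt_scale_def del: of_int_diff)
  qed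
qed

text \<open>Both products are double sums over one raise and one lowering. Unless the two moves
  concern the same entry, the terms agree by the exchange identity; the remaining ones are squares
  of coefficients times \<open>v \<eta>\<close>.\<close>

lemma br_unit_op_E_F:
  assumes "1 \<le> r" "r < n" "1 \<le> s" "s < n"
  shows "br (unit_op n m r (Suc r)) (unit_op n m (Suc s) s) =
    (if r = s then unit_op n m r r - unit_op n m (Suc r) (Suc r) else 0)"
proof (rule gt_operator_eqI)
  fix v \<eta>
  let ?c = "\<lambda>r j \<xi>. complex_of_real (gt_coeff n m r j \<xi>)"
  let ?EF = "\<lambda>j i. ?c r j (gt_shift j r (- 1) \<eta>) * ?c s i (gt_shift j r (- 1) \<eta>)
      * v (gt_shift i s 1 (gt_shift j r (- 1) \<eta>))"
  let ?FE = "\<lambda>j i. ?c s i \<eta> * ?c r j (gt_shift i s 1 (gt_shift j r (- 1) \<eta>))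
      * v (gt_shift i s 1 (gt_shift j r (- 1) \<eta>))"
  have off_diagonal: "?EF j i = ?FE j i" if "(j, r) \<noteq> (i, s)" for i j
  proof -
    have "gt_coeff n m r j (gt_shift j r (- 1) \<eta>) * gt_coeff n m s i (gt_shift j r (- 1) \<eta>) =
      gt_coeff n m s i \<eta> * gt_coeff n m r j (gt_shift i s 1 (gt_shift j r (- 1) \<eta>))"
      using gt_coeff_exchange[OF that, of n m "gt_shift j r (- 1) \<eta>"] by (simp add: mult.commute)
    then show ?thesis by (simp flip: of_real_mult)
  qed
  have "app_op (br (unit_op n m r (Suc r)) (unit_op n m (Suc s) s)) v \<eta> =
      (\<Sum>j = 1..r. \<Sum>i = 1..s. ?EF j i) - (\<Sum>i = 1..s. \<Sum>j = 1..r. ?FE j i)"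
    using assms by (simp add: br_def app_E app_F gt_E_apply gt_F_apply sum_distrib_left mult.assoc
        gt_shift_commute[of _ s _ _ r])
  also have "\<dots> = (\<Sum>j = 1..r. \<Sum>i = 1..s. ?EF j i - ?FE j i)"
    by (subst (2) sum.swap) (simp add: sum_subtractf)
  also have "\<dots> = app_op (if r = s then unit_op n m r r - unit_op n m (Suc r) (Suc r) else 0) v \<eta>"
  proof (cases "r = s")
    case False
    then have "(\<Sum>j = 1..r. \<Sum>i = 1..s. ?EF j i - ?FE j i) = 0"
      by (intro sum.neutral ballI) (rule right_minus_eq[THEN iffD2], rule off_diagonal, simp)
    with False show ?thesis by simp
  next
    case True
    have "(\<Sum>j = 1..r. \<Sum>i = 1..s. ?EF j i - ?FE j i) =
        (\<Sum>j = 1..r. \<Sum>i = 1..r. if i = j then ?EF j i - ?FE j i else 0)"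
      using True off_diagonal by (intro sum.cong) auto
    also have "\<dots> = (\<Sum>j = 1..r. ?EF j j - ?FE j j)" by simp
    also have "\<dots> = of_real (\<Sum>j = 1..r. (gt_coeff n m r j (gt_shift j r (- 1) \<eta>))\<^sup>2 - (gt_coeff n m r j \<eta>)\<^sup>2) * v \<eta>"
      unfolding of_real_sum sum_distrib_right
      by (intro sum.cong) (auto simp: True power2_eq_square algebra_simps)
    also have "\<dots> = (gt_H n m r v - gt_H n m (Suc r) v) \<eta>"
    proof (cases "\<eta> \<in> gt_patterns n m")
      case \<eta>: True
      have eq: "of_real (\<Sum>j = 1..r. (gt_coeff n m r j (gt_shift j r (- 1) \<eta>))\<^sup>2 - (gt_coeff n m r j \<eta>)\<^sup>2) =
          (of_int (gt_weight r \<eta> - gt_weight (Suc r) \<eta>) :: complex)"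
        unfolding sum_gt_coeff_squares[OF \<eta> assms(1,2)] of_real_of_int_eq
        by (intro arg_cong[of _ _ of_int]) (simp add: gt_weight_def)
      show ?thesis unfolding eq using \<eta> by (simp add: gt_H_apply algebra_simps)
    next
      case False
      then show ?thesis by (simp add: gt_H_apply gt_coeff_nonpattern)
    qed
    finally show ?thesis using True by (simp add: app_H)
  qed
  finally show "app_op (br (unit_op n m r (Suc r)) (unit_op n m (Suc s) s)) v \<eta> =
      app_op (if r = s then unit_op n m r r - unit_op n m (Suc r) (Suc r) else 0) v \<eta>" .
qed

section \<open>The grading by the sum of all entries\<close>

definition gt_degree :: "nat \<Rightarrow> gt_array \<Rightarrow> int" where
  "gt_degree n \<xi> = (\<Sum>k = 1..n. \<Sum>i = 1..k. \<xi> i k)"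

lemma gt_degree_shift:
  assumes "1 \<le> j" "j \<le> r" "r \<le> n"
  shows "gt_degree n (gt_shift j r d \<xi>) = gt_degree n \<xi> + d"
proof -
  have "gt_degree n (gt_shift j r d \<xi>) =
      (\<Sum>k = 1..n. \<Sum>i = 1..k. \<xi> i k + (if i = j then (if k = r then d else 0) else 0))"
    unfolding gt_degree_def by (intro sum.cong) (auto simp: gt_shift_apply)
  also have "\<dots> = gt_degree n \<xi> + (\<Sum>k = 1..n. if k = r then d else 0)"
  proof -
    have "(\<Sum>i = 1..k. if i = j then (if k = r then d else 0) else 0) = (if k = r then d else 0)" for k
      using assms by auto
    then show ?thesis by (simp only: gt_degree_def sum.distrib)
  qed
  finally show ?thesis using assms by simp
qed

lemma gt_degree_bounds:
  obtains b where "\<And>\<xi>. \<xi> \<in> gt_patterns n m \<Longrightarrow> \<bar>gt_degree n \<xi>\<bar> \<le> int b"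
proof -
  let ?D = "(\<lambda>\<xi>. nat \<bar>gt_degree n \<xi>\<bar>) ` gt_patterns n m"
  have "\<bar>gt_degree n \<xi>\<bar> \<le> int (Max ?D)" if "\<xi> \<in> gt_patterns n m" for \<xi>
  proof -
    have "nat \<bar>gt_degree n \<xi>\<bar> \<le> Max ?D" using that by (intro Max_ge) auto
    then show ?thesis by linarith
  qed
  then show thesis using that by blast
qed

text \<open>An operator that changes the degree by exactly 1 in a fixed direction dies out, since
  the patterns have bounded degree. The sign of \<open>d\<close> covers E and F at once.\<close>

lemma gt_nilpotent:
  assumes outside: "\<And>v \<eta>. \<eta> \<notin> gt_patterns n m \<Longrightarrow> app_op f v \<eta> = 0"
    and step: "\<And>v \<eta>. app_op f v \<eta> \<noteq> 0 \<Longrightarrow> \<exists>\<xi>. v \<xi> \<noteq> 0 \<and> gt_degree n \<xi> = gt_degree n \<eta> + d"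
    and "\<bar>d\<bar> = 1"
  shows "\<exists>N. f ^ N = 0"
proof -
  obtain b where b: "\<And>\<xi>. \<xi> \<in> gt_patterns n m \<Longrightarrow> \<bar>gt_degree n \<xi>\<bar> \<le> int b"
    using gt_degree_bounds by blast
  \<comment> \<open>The exponent is \<open>Suc k\<close> because \<open>v\<close> is arbitrary: only
    after one application of \<open>f\<close> is the support known to consist of patterns.\<close>
  have power: "\<exists>\<xi> \<in> gt_patterns n m. gt_degree n \<xi> = gt_degree n \<eta> + int k * d \<and> \<eta> \<in> gt_patterns n m"
    if "app_op (f ^ Suc k) v \<eta> \<noteq> 0" for k v \<eta>
    using that
  proof (induction k arbitrary: \<eta>)
    case 0
    then show ?case using outside by (intro bexI[of _ \<eta>]) auto
  next
    case (Suc k)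
    then have nz: "app_op f (app_op (f ^ Suc k) v) \<eta> \<noteq> 0" by simp
    then obtain \<zeta> where "app_op (f ^ Suc k) v \<zeta> \<noteq> 0" "gt_degree n \<zeta> = gt_degree n \<eta> + d"
      using step by blast
    with Suc.IH[of \<zeta>] nz outside show ?case by (fastforce simp: algebra_simps)
  qed
  \<comment> \<open>Degrees of two patterns differ by at most \<open>2 * b\<close>.\<close>
  have "f ^ Suc (2 * b + 1) = 0"
  proof (rule gt_operator_eqI, rule ccontr)
    fix v \<eta> assume "app_op (f ^ Suc (2 * b + 1)) v \<eta> \<noteq> app_op 0 v \<eta>"
    then obtain \<xi> where "\<xi> \<in> gt_patterns n m" "\<eta> \<in> gt_patterns n m"
      "gt_degree n \<xi> = gt_degree n \<eta> + int (2 * b + 1) * d"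
      using power[of "2 * b + 1" v \<eta>] by auto
    with b[of \<xi>] b[of \<eta>] assms(3) show False by (cases "d \<ge> 0") auto
  qed
  then show ?thesis ..
qed

lemma gt_E_nonzero_source:
  assumes "gt_E n m (Suc r) v \<eta> \<noteq> 0" "r < n"
  shows "\<exists>\<xi>. v \<xi> \<noteq> 0 \<and> gt_degree n \<xi> = gt_degree n \<eta> + (- 1)"
proof -
  obtain j where "j \<in> {1..r}" "v (gt_shift j r (- 1) \<eta>) \<noteq> 0"
    using assms sum.not_neutral_contains_not_neutral unfolding gt_E_apply by force
  with assms(2) show ?thesis
    by (intro exI[of _ "gt_shift j r (- 1) \<eta>"]) (simp add: gt_degree_shift)
qed

lemma gt_F_nonzero_source:
  assumes "gt_F n m (Suc r) v \<eta> \<noteq> 0" "1 \<le> r" "r < n"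
  shows "\<exists>\<xi>. v \<xi> \<noteq> 0 \<and> gt_degree n \<xi> = gt_degree n \<eta> + 1"
proof -
  obtain j where "j \<in> {1..r}" "v (gt_shift j r 1 \<eta>) \<noteq> 0"
    using assms sum.not_neutral_contains_not_neutral unfolding gt_F_apply[OF assms(2)] by force
  with assms(3) show ?thesis
    by (intro exI[of _ "gt_shift j r 1 \<eta>"]) (simp add: gt_degree_shift)
qed

lemma gl_generators_unit_op: "gl_generators n (unit_op n m)"
proof
  fix p q assume "1 \<le> p" "p < q" "q < n"
  then show "unit_op n m p (Suc q) = br (unit_op n m p q) (unit_op n m q (Suc q))"
    by (intro gt_operator_eqI)
      (simp add: br_def app_unit_op gt_unit.simps[of n m p "Suc q"] commutator_op_def)
next
  fix p q assume "1 \<le> q" "q < p" "p < n"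
  then show "unit_op n m (Suc p) q = br (unit_op n m (Suc p) p) (unit_op n m p q)"
    by (intro gt_operator_eqI)
      (simp add: br_def app_unit_op gt_unit.simps[of n m "Suc p" q] commutator_op_def)
next
  fix p q
  show "br (unit_op n m p p) (unit_op n m q q) = 0"
    by (intro gt_operator_eqI) (simp add: br_def app_H gt_H_apply)
next
  fix i assume "1 \<le> i" "i < n"
  then show "\<exists>N. unit_op n m i (Suc i) ^ N = 0"
    by (intro gt_nilpotent[where d = "- 1" and n = n and m = m])
      (auto simp: app_E gt_E_outside intro!: gt_E_nonzero_source[simplified])
  show "\<exists>N. unit_op n m (Suc i) i ^ N = 0"
    using \<open>1 \<le> i\<close> \<open>i < n\<close>
    by (intro gt_nilpotent[where d = 1 and n = n and m = m])
      (auto simp: app_F gt_F_outside intro!: gt_F_nonzero_source)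
qed (simp_all only: gt_operator_torsion_free br_unit_op_H_E br_unit_op_H_F br_unit_op_E_F)


section \<open>The action of sl_n as a sum over all matrix units\<close>

lemma sum_abel:
  fixes x h :: "nat \<Rightarrow> 'a::comm_ring"
  shows "(\<Sum>k = 1..N. (\<Sum>i = 1..k. x i) * (h k - h (Suc k))) =
    (\<Sum>k = 1..Suc N. x k * h k) - (\<Sum>i = 1..Suc N. x i) * h (Suc N)"
  by (induction N) (simp_all add: algebra_simps)

lemma sl_trace:
  assumes "X \<in> sl n"
  shows "(\<Sum>i = 1..n. X $$ (i - 1, i - 1)) = 0"
  using assms by (simp add: sl_def sum.atLeast1_atMost_eq)

lemma app_op_zero: "app_op f 0 = 0"
  using app_op_add[of f 0 0] by simp

lemma app_op_sum: "app_op f (\<Sum>x\<in>A. g x) = (\<Sum>x\<in>A. app_op f (g x))"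
  by (induction A rule: infinite_finite_induct) (simp_all only: sum.infinite sum.empty sum.insert app_op_zero app_op_add not_False_eq_True)

text \<open>Summation by parts replaces the differences H_k - H_{k+1} by the single H_k; its
  boundary term is the trace times H_n, hence 0.\<close>

lemma gt_action_eq:
  assumes "X \<in> sl n" "1 \<le> n"
  shows "gt_action n m X v =
    (\<Sum>(p, q)\<in>{1..n} \<times> {1..n}. gt_scale (X $$ (p - 1, q - 1)) (app_op (unit_op n m p q) v))"
proof
  fix \<eta>
  define x where "x p q = X $$ (p - 1, q - 1)" for p q
  define h where "h k = gt_H n m k v \<eta>" for k
  have "Suc (n - 1) = n" using assms(2) by simp
  moreover have "(\<Sum>i = 1..n. x i i) = 0" using sl_trace[OF assms(1)] by (simp add: x_def)
  ultimately have diagonal: "(\<Sum>k = 1..n - 1. (\<Sum>i = 1..k. x i i) * (h k - h (Suc k))) = (\<Sum>k = 1..n. x k k * h k)"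
    using sum_abel[of "\<lambda>i. x i i" h "n - 1"] by simp
  have "gt_action n m X v \<eta> = (\<Sum>p = 1..n. \<Sum>q\<in>{1..n} - {p}. x p q * gt_unit n m p q v \<eta>) +
      (\<Sum>k = 1..n - 1. (\<Sum>i = 1..k. x i i) * (h k - h (Suc k)))"
    by (simp add: gt_action_def sum_fun_apply gt_scale_def h_def x_def)
  also have "\<dots> = (\<Sum>p = 1..n. \<Sum>q\<in>{1..n} - {p}. x p q * gt_unit n m p q v \<eta>) + (\<Sum>k = 1..n. x k k * h k)"
    unfolding diagonal ..
  also have "\<dots> = (\<Sum>p = 1..n. x p p * h p + (\<Sum>q\<in>{1..n} - {p}. x p q * gt_unit n m p q v \<eta>))"
    by (simp add: sum.distrib)
  also have "\<dots> = (\<Sum>p = 1..n. \<Sum>q = 1..n. x p q * app_op (unit_op n m p q) v \<eta>)"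
  proof (intro sum.cong refl)
    fix p assume "p \<in> {1..n}"
    then have "(\<Sum>q = 1..n. x p q * app_op (unit_op n m p q) v \<eta>) =
        x p p * app_op (unit_op n m p p) v \<eta> + (\<Sum>q\<in>{1..n} - {p}. x p q * app_op (unit_op n m p q) v \<eta>)"
      by (intro sum.remove) auto
    also have "\<dots> = x p p * h p + (\<Sum>q\<in>{1..n} - {p}. x p q * gt_unit n m p q v \<eta>)"
      by (intro arg_cong2[of _ _ _ _ "(+)"] sum.cong) (auto simp: app_unit_op h_def)
    finally show "x p p * h p + (\<Sum>q\<in>{1..n} - {p}. x p q * gt_unit n m p q v \<eta>) =
        (\<Sum>q = 1..n. x p q * app_op (unit_op n m p q) v \<eta>)" by simp
  qed
  finally show "gt_action n m X v \<eta> =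
      (\<Sum>(p, q)\<in>{1..n} \<times> {1..n}. gt_scale (X $$ (p - 1, q - 1)) (app_op (unit_op n m p q) v)) \<eta>"
    by (simp add: sum_fun_apply sum.cartesian_product case_prod_unfold gt_scale_def x_def)
qed

lemma gt_unit_outside:
  assumes "1 \<le> p" "1 \<le> q" "\<eta> \<notin> gt_patterns n m"
  shows "gt_unit n m p q v \<eta> = 0"
  using assms
proof (induction n m p q arbitrary: v rule: gt_unit.induct)
  case (1 n m p q)
  note IH = "1.IH" and prems = "1.prems"
  consider "q = Suc p" | "p = Suc q" | "Suc p < q" | "Suc q < p" | "p = q" by linarith
  then show ?case
  proof cases
    case 3
    then have "gt_unit n m p (q - 1) w \<eta> = 0" "gt_unit n m (q - 1) q w \<eta> = 0" for w
      using IH prems by auto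
    with 3 show ?thesis unfolding gt_unit.simps[of n m p q] by (simp add: commutator_op_def)
  next
    case 4
    then have "gt_unit n m p (p - 1) w \<eta> = 0" "gt_unit n m (p - 1) q w \<eta> = 0" for w
      using IH prems by auto
    with 4 show ?thesis unfolding gt_unit.simps[of n m p q] by (simp add: commutator_op_def)
  qed (use prems in \<open>simp_all add: gt_unit.simps[of n m p "Suc p"] gt_unit.simps[of n m "Suc q" q]
      gt_unit.simps[of n m q q] gt_E_outside gt_F_outside\<close>)
qed

lemma unit_op_outside:
  assumes "1 \<le> p" "1 \<le> q" "\<eta> \<notin> gt_patterns n m"
  shows "app_op (unit_op n m p q) v \<eta> = 0"
  using assms by (simp add: app_unit_op gt_H_apply gt_unit_outside)

text \<open>Contracting the inner indices multiplies the coefficients as matrices; this is how X * Y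
  emerges from the brackets of units.\<close>

lemma sum_matrix_units:
  fixes x y w :: "nat \<Rightarrow> nat \<Rightarrow> complex"
  shows "(\<Sum>(p, q)\<in>A \<times> A. \<Sum>(r, s)\<in>A \<times> A. x p q * y r s * (if q = r then w p s else 0)) =
    (\<Sum>(p, s)\<in>A \<times> A. (\<Sum>q\<in>A. x p q * y q s) * w p s)"
proof (cases "finite A")
  case True
  have "(\<Sum>(p, q)\<in>A \<times> A. \<Sum>(r, s)\<in>A \<times> A. x p q * y r s * (if q = r then w p s else 0)) =
      (\<Sum>p\<in>A. \<Sum>q\<in>A. \<Sum>s\<in>A. \<Sum>r\<in>A. if q = r then x p q * y r s * w p s else 0)"
    unfolding sum.cartesian_product[symmetric]
    by (rule sum.cong[OF refl], rule sum.cong[OF refl], subst sum.swap,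
        rule sum.cong[OF refl], rule sum.cong[OF refl]) simp
  also have "\<dots> = (\<Sum>p\<in>A. \<Sum>q\<in>A. \<Sum>s\<in>A. x p q * y q s * w p s)"
    using True by (intro sum.cong refl) simp
  also have "\<dots> = (\<Sum>p\<in>A. \<Sum>s\<in>A. \<Sum>q\<in>A. x p q * y q s * w p s)"
    by (intro sum.cong refl sum.swap)
  finally show ?thesis by (simp add: sum.cartesian_product[symmetric] sum_distrib_right)
next
  case False
  then show ?thesis by (cases "A = {}") (simp_all add: finite_cartesian_product_iff)
qed

lemma app_op_gt_action:
  assumes "X \<in> sl n" "1 \<le> n"
  shows "app_op f (gt_action n m X v) \<eta> =
    (\<Sum>(p, q)\<in>{1..n} \<times> {1..n}. X $$ (p - 1, q - 1) * app_op f (app_op (unit_op n m p q) v) \<eta>)"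
  unfolding gt_action_eq[OF assms] app_op_sum sum_fun_apply case_prod_unfold app_op_scale
  by (simp add: gt_scale_def)

lemma gt_action_apply:
  assumes "X \<in> sl n" "1 \<le> n"
  shows "gt_action n m X v \<eta> =
    (\<Sum>(p, q)\<in>{1..n} \<times> {1..n}. X $$ (p - 1, q - 1) * app_op (unit_op n m p q) v \<eta>)"
  using app_op_gt_action[OF assms, of 1] by simp

lemma commutator_mat_index:
  assumes "X \<in> sl n" "Y \<in> sl n" "1 \<le> p" "p \<le> n" "1 \<le> q" "q \<le> n"
  shows "commutator_mat X Y $$ (p - 1, q - 1) =
    (\<Sum>k = 1..n. X $$ (p - 1, k - 1) * Y $$ (k - 1, q - 1)) - (\<Sum>k = 1..n. Y $$ (p - 1, k - 1) * X $$ (k - 1, q - 1))"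
proof -
  have dims: "dim_row X = n" "dim_col X = n" "dim_row Y = n" "dim_col Y = n"
    using assms by (auto simp: sl_def)
  have "p - 1 < n" "q - 1 < n" using assms by auto
  then show ?thesis
    by (simp add: commutator_mat_def dims scalar_prod_def sum.atLeast1_atMost_eq atLeast0LessThan)
qed

lemma commutator_mat_sl:
  assumes "X \<in> sl n" "Y \<in> sl n"
  shows "commutator_mat X Y \<in> sl n"
proof -
  have "(\<Sum>i<n. commutator_mat X Y $$ (i, i)) = (\<Sum>p = 1..n. commutator_mat X Y $$ (p - 1, p - 1))"
    by (simp add: sum.atLeast1_atMost_eq)
  also have "\<dots> = (\<Sum>p = 1..n. (\<Sum>k = 1..n. X $$ (p - 1, k - 1) * Y $$ (k - 1, p - 1)) -
      (\<Sum>k = 1..n. Y $$ (p - 1, k - 1) * X $$ (k - 1, p - 1)))"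
    by (intro sum.cong refl commutator_mat_index[OF assms]) auto
  also have "\<dots> = 0"
    unfolding sum_subtractf by (subst sum.swap) (simp add: mult.commute)
  finally show ?thesis using assms
    by (auto simp: sl_def commutator_mat_def intro!: minus_carrier_mat mult_carrier_mat)
qed

lemma gt_action_commutator:
  assumes "X \<in> sl n" "Y \<in> sl n" "1 \<le> n"
  shows "gt_action n m (commutator_mat X Y) v =
    gt_action n m X (gt_action n m Y v) - gt_action n m Y (gt_action n m X v)"
proof
  interpret gl_generators n "unit_op n m" by (rule gl_generators_unit_op)
  fix \<eta>
  define x y where "x p q = X $$ (p - 1, q - 1)" and "y p q = Y $$ (p - 1, q - 1)" for p q
  let ?I = "{1..n} \<times> {1..n}"
  let ?U = "\<lambda>p q. app_op (unit_op n m p q)"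
  have XY: "gt_action n m X (gt_action n m Y v) \<eta> =
      (\<Sum>(p, q)\<in>?I. \<Sum>(r, s)\<in>?I. x p q * y r s * ?U p q (?U r s v) \<eta>)"
    by (simp only: gt_action_apply[OF assms(1,3)] app_op_gt_action[OF assms(2,3)]
        case_prod_unfold sum_distrib_left mult.assoc x_def y_def)
  have YX: "gt_action n m Y (gt_action n m X v) \<eta> =
      (\<Sum>(r, s)\<in>?I. \<Sum>(p, q)\<in>?I. y r s * x p q * ?U r s (?U p q v) \<eta>)"
    by (simp only: gt_action_apply[OF assms(2,3)] app_op_gt_action[OF assms(1,3)]
        case_prod_unfold sum_distrib_left mult.assoc x_def y_def)
  have bracket: "?U p q (?U r s v) \<eta> - ?U r s (?U p q v) \<eta> =
      (if q = r then ?U p s v \<eta> else 0) - (if s = p then ?U r q v \<eta> else 0)"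
    if "(p, q) \<in> ?I" "(r, s) \<in> ?I" for p q r s
  proof -
    have "app_op (br (unit_op n m p q) (unit_op n m r s)) v \<eta> =
        app_op ((if q = r then unit_op n m p s else 0) - (if s = p then unit_op n m r q else 0)) v \<eta>"
      using that by (subst br_unit) auto
    then show ?thesis by (simp add: br_def split: if_splits)
  qed
  have scaled_bracket: "c * ?U p q (?U r s v) \<eta> - c * ?U r s (?U p q v) \<eta> =
      c * (if q = r then ?U p s v \<eta> else 0) - c * (if s = p then ?U r q v \<eta> else 0)"
    if "(p, q) \<in> ?I" "(r, s) \<in> ?I" for c p q r s
    unfolding right_diff_distrib[symmetric] bracket[OF that] ..
  have "(gt_action n m X (gt_action n m Y v) - gt_action n m Y (gt_action n m X v)) \<eta> =
      (\<Sum>(p, q)\<in>?I. \<Sum>(r, s)\<in>?I. x p q * y r s * ?U p q (?U r s v) \<eta>) -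
      (\<Sum>(p, q)\<in>?I. \<Sum>(r, s)\<in>?I. x p q * y r s * ?U r s (?U p q v) \<eta>)"
    unfolding minus_apply XY YX case_prod_unfold by (subst (3) sum.swap) (simp add: mult.commute)
  also have "\<dots> = (\<Sum>(p, q)\<in>?I. \<Sum>(r, s)\<in>?I. x p q * y r s * (if q = r then ?U p s v \<eta> else 0)) -
      (\<Sum>(p, q)\<in>?I. \<Sum>(r, s)\<in>?I. x p q * y r s * (if s = p then ?U r q v \<eta> else 0))"
    unfolding sum_subtractf[symmetric] case_prod_unfold
    by (intro sum.cong refl scaled_bracket) auto
  \<comment> \<open>Interchanging the two sums makes this half an instance of
    \<open>sum_matrix_units\<close> with X and Y exchanged.\<close>
  also have "(\<Sum>(p, q)\<in>?I. \<Sum>(r, s)\<in>?I. x p q * y r s * (if s = p then ?U r q v \<eta> else 0)) =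
      (\<Sum>(r, s)\<in>?I. \<Sum>(p, q)\<in>?I. y r s * x p q * (if s = p then ?U r q v \<eta> else 0))"
    unfolding case_prod_unfold by (subst sum.swap) (simp add: mult.commute)
  also have "(\<Sum>(p, q)\<in>?I. \<Sum>(r, s)\<in>?I. x p q * y r s * (if q = r then ?U p s v \<eta> else 0)) -
      (\<Sum>(r, s)\<in>?I. \<Sum>(p, q)\<in>?I. y r s * x p q * (if s = p then ?U r q v \<eta> else 0)) =
      (\<Sum>(p, s)\<in>?I. ((\<Sum>k = 1..n. x p k * y k s) - (\<Sum>k = 1..n. y p k * x k s)) * ?U p s v \<eta>)"
    unfolding sum_matrix_units by (simp add: case_prod_unfold left_diff_distrib sum_subtractf)
  also have "\<dots> = gt_action n m (commutator_mat X Y) v \<eta>"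
    unfolding gt_action_eq[OF commutator_mat_sl[OF assms(1,2)] assms(3)] sum_fun_apply
    by (intro sum.cong refl) (auto simp: gt_scale_def x_def y_def commutator_mat_index[OF assms(1,2), unfolded One_nat_def])
  finally show "gt_action n m (commutator_mat X Y) v \<eta> =
      (gt_action n m X (gt_action n m Y v) - gt_action n m Y (gt_action n m X v)) \<eta>" by simp
qed

lemma vector_space_gt_scale: "vector_space gt_scale"
  by unfold_locales (auto simp: gt_scale_def algebra_simps)

lemma sl_carrier: "X \<in> sl n \<Longrightarrow> X \<in> carrier_mat n n"
  by (simp add: sl_def)

lemma sl_add:
  assumes "X \<in> sl n" "Y \<in> sl n"
  shows "X + Y \<in> sl n"
  using assms by (auto simp: sl_def sum.distrib)

lemma sl_smult:
  assumes "X \<in> sl n"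
  shows "c \<cdot>\<^sub>m X \<in> sl n"
  using assms by (auto simp: sl_def simp flip: sum_distrib_left)

lemma sl_module_gt:
  assumes "1 \<le> n"
  shows "sl_module gt_scale n (gt_space n m) (gt_action n m)"
proof -
  interpret vector_space gt_scale by (rule vector_space_gt_scale)
  show ?thesis
  proof
    show "subspace (gt_space n m)"
      by (auto simp: subspace_def gt_space_def gt_scale_def)
  next
    fix X v assume X: "X \<in> sl n"
    show "gt_action n m X v \<in> gt_space n m"
      unfolding gt_space_def gt_action_eq[OF X assms] sum_fun_apply
      by (auto intro!: sum.neutral simp: gt_scale_def unit_op_outside)
    show "gt_action n m X (v + w) = gt_action n m X v + gt_action n m X w" for w
      unfolding gt_action_eq[OF X assms] by (simp add: app_op_add scale_right_distrib case_prod_unfold sum.distrib)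
    show "gt_action n m X (gt_scale c v) = gt_scale c (gt_action n m X v)" for c
      unfolding gt_action_eq[OF X assms] scale_sum_right
      by (intro sum.cong refl) (auto simp: app_op_scale mult.commute)
    show "gt_action n m (c \<cdot>\<^sub>m X) v = gt_scale c (gt_action n m X v)" for c
      unfolding gt_action_eq[OF X assms] gt_action_eq[OF sl_smult[OF X] assms] scale_sum_right
      using sl_carrier[OF X] by (intro sum.cong refl) auto
    fix Y assume Y: "Y \<in> sl n"
    show "gt_action n m (X + Y) v = gt_action n m X v + gt_action n m Y v"
      unfolding gt_action_eq[OF X assms] gt_action_eq[OF Y assms] gt_action_eq[OF sl_add[OF X Y] assms]
        sum.distrib[symmetric]
      using sl_carrier[OF X] sl_carrier[OF Y] by (intro sum.cong refl) (auto simp: scale_left_distrib)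
    show "gt_action n m (commutator_mat X Y) v =
        gt_action n m X (gt_action n m Y v) - gt_action n m Y (gt_action n m X v)"
      by (rule gt_action_commutator[OF X Y assms])
  qed
qed


section \<open>Simplicity\<close>

definition gt_top :: "nat \<Rightarrow> (nat \<Rightarrow> int) \<Rightarrow> gt_array" where
  "gt_top n m = (\<lambda>i k. if 1 \<le> i \<and> i \<le> k \<and> k \<le> n then m i else 0)"

lemma gt_top_pattern:
  assumes "\<And>i. 1 \<le> i \<Longrightarrow> i < n \<Longrightarrow> m i \<ge> m (i + 1)"
  shows "gt_top n m \<in> gt_patterns n m"
  by (rule gt_patternI) (use assms in \<open>auto simp: gt_top_def\<close>)

lemma gt_coeff_nonzero:
  assumes "\<xi> \<in> gt_patterns n m" "gt_shift j r 1 \<xi> \<in> gt_patterns n m"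
  shows "gt_coeff n m r j \<xi> \<noteq> 0"
  using assms gt_radicand_pos[OF assms] by (simp add: gt_coeff_def gt_a_eq)

text \<open>Once the rows below r agree with their successors on the support of v, at most one basis
  vector in the support contributes to each coordinate of E v in row r, so nothing can cancel.\<close>

lemma highest_support:
  assumes v: "v \<in> gt_space n m" and highest: "\<And>r. \<lbrakk>1 \<le> r; r < n\<rbrakk> \<Longrightarrow> gt_E n m (Suc r) v = 0"
    and "v \<xi> \<noteq> 0"
  shows "\<xi> = gt_top n m"
proof -
  have rows: "\<forall>\<xi>. v \<xi> \<noteq> 0 \<longrightarrow> (\<forall>k<r. \<forall>i\<in>{1..k}. \<xi> i k = \<xi> i (Suc k))" if "r \<le> n" for r
    using that
  proof (induction r)
    case (Suc r)
    have IH: "\<zeta> i k = \<zeta> i (Suc k)" if "v \<zeta> \<noteq> 0" "k < r" "1 \<le> i" "i \<le> k" for \<zeta> i k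
      using Suc that by auto
    have "\<zeta> j r = \<zeta> j (Suc r)" if "v \<zeta> \<noteq> 0" "1 \<le> j" "j \<le> r" for \<zeta> j
    proof (rule ccontr)
      assume ne: "\<zeta> j r \<noteq> \<zeta> j (Suc r)"
      have r: "r < n" "1 \<le> r" using Suc.prems that by auto
      have \<zeta>: "\<zeta> \<in> gt_patterns n m" using v that by (auto simp: gt_space_def)
      have less: "\<zeta> j r < \<zeta> j (Suc r)"
        using gt_pattern_interlace(1)[OF \<zeta> that(2,3) r(1)] ne by simp
      \<comment> \<open>The entry in row r - 1 equals its successor at (j - 1, r), which interlacing
        puts at or above (j, r + 1), which exceeds (j, r). So nothing blocks raising at
        \<open>j\<close>.\<close>
      have "\<zeta> j r < \<zeta> (j - 1) (r - 1)" if "2 \<le> j"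
      proof -
        have "\<zeta> (j - 1) (r - 1) = \<zeta> (j - 1) (Suc (r - 1))"
          using \<open>v \<zeta> \<noteq> 0\<close> \<open>j \<le> r\<close> that r by (intro IH) auto
        moreover have "\<zeta> j (Suc r) \<le> \<zeta> (j - 1) r"
          using gt_pattern_interlace(2)[OF \<zeta>, of "j - 1" r] that \<open>j \<le> r\<close> r by fastforce
        ultimately show ?thesis using less r by simp
      qed
      then have \<eta>: "gt_shift j r 1 \<zeta> \<in> gt_patterns n m" (is "?\<eta> \<in> _")
        using gt_shift_up_mem[OF \<zeta> that(2,3) r(1) less] by blast
      have other: "v (gt_shift i r (- 1) ?\<eta>) = 0" if "i \<in> {1..r} - {j}" for i
      proof (rule ccontr)
        assume nz: "v (gt_shift i r (- 1) ?\<eta>) \<noteq> 0"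
        \<comment> \<open>Since p \<le> r - 1, entry \<open>p\<close> of row \<open>r\<close> is
          determined by row r - 1, which this array shares with \<open>\<zeta>\<close>; yet the two
          arrays differ there.\<close>
        define p where "p = min i j"
        then have p: "p = i \<or> p = j" "1 \<le> p" "p \<le> r - 1"
          using \<open>1 \<le> j\<close> \<open>j \<le> r\<close> \<open>i \<in> {1..r} - {j}\<close> by (auto simp: min_def)
        then have "r - 1 < r" "r - 1 \<noteq> r" "Suc (r - 1) = r" by auto
        with IH[OF nz, of "r - 1" p] IH[OF \<open>v \<zeta> \<noteq> 0\<close>, of "r - 1" p] p that
        show False by (auto simp: gt_shift_apply)
      qed
      have "0 = gt_E n m (Suc r) v ?\<eta>" using highest[OF r(2,1)] by simp
      also have "\<dots> = (\<Sum>i = 1..r. complex_of_real (gt_coeff n m r i (gt_shift i r (- 1) ?\<eta>)) * v (gt_shift i r (- 1) ?\<eta>))"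
        by (rule gt_E_apply)
      also have "\<dots> = complex_of_real (gt_coeff n m r j (gt_shift j r (- 1) ?\<eta>)) * v (gt_shift j r (- 1) ?\<eta>)"
        using that by (subst sum.remove[of _ j]) (auto simp: other intro!: sum.neutral)
      also have "\<dots> = complex_of_real (gt_coeff n m r j \<zeta>) * v \<zeta>" by simp
      finally show False using gt_coeff_nonzero[OF \<zeta> \<eta>] \<open>v \<zeta> \<noteq> 0\<close> by simp
    qed
    with IH show ?case by (auto simp: less_Suc_eq)
  qed simp
  have \<xi>: "\<xi> \<in> gt_patterns n m" using v assms(3) by (auto simp: gt_space_def)
  have "\<xi> i k = m i" if "1 \<le> i" "i \<le> k" "k \<le> n" for i k
    using that(3,2)
  proof (induction k rule: inc_induct)
    case base
    then show ?case using gt_pattern_top_row[OF \<xi> that(1)] by simp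
  next
    case (step k)
    then show ?case using rows[of n] assms(3) that(1) by auto
  qed
  then show ?thesis
    using gt_pattern_outside[OF \<xi>] by (intro ext) (auto simp: gt_top_def)
qed

text \<open>Raising increases degrees on the support by 1, so it must stop within the bounded range.
  \<open>N\<close> measures the room left below the maximal degree.\<close>

lemma exists_highest_vector:
  assumes stable: "\<And>r w. \<lbrakk>1 \<le> r; r < n; w \<in> W\<rbrakk> \<Longrightarrow> gt_E n m (Suc r) w \<in> W"
    and "W \<subseteq> gt_space n m" "w \<in> W" "w \<noteq> 0"
  obtains u where "u \<in> W" "u \<noteq> 0" "\<And>r. \<lbrakk>1 \<le> r; r < n\<rbrakk> \<Longrightarrow> gt_E n m (Suc r) u = 0"
proof -
  obtain b where b: "\<And>\<xi>. \<xi> \<in> gt_patterns n m \<Longrightarrow> \<bar>gt_degree n \<xi>\<bar> \<le> int b"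
    using gt_degree_bounds by blast
  have support: "\<bar>gt_degree n \<xi>\<bar> \<le> int b" if "v \<in> W" "v \<xi> \<noteq> 0" for v \<xi>
    using that assms(2) b by (auto simp: gt_space_def)
  have "\<exists>u\<in>W. u \<noteq> 0 \<and> (\<forall>r. 1 \<le> r \<longrightarrow> r < n \<longrightarrow> gt_E n m (Suc r) u = 0)"
    if "v \<in> W" "v \<noteq> 0" "\<And>\<xi>. v \<xi> \<noteq> 0 \<Longrightarrow> gt_degree n \<xi> \<ge> int b - int N" for N v
    using that
  proof (induction N arbitrary: v)
    case (0 v)
    have "gt_E n m (Suc r) v = 0" if r: "1 \<le> r" "r < n" for r
    proof (rule ext, rule ccontr)
      fix \<eta> assume nz: "gt_E n m (Suc r) v \<eta> \<noteq> 0 \<eta>"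
      then obtain \<xi> where "v \<xi> \<noteq> 0" "gt_degree n \<xi> = gt_degree n \<eta> + (- 1)"
        using gt_E_nonzero_source[of n m r v \<eta>] r by auto
      with 0(3)[of \<xi>] support[OF stable[OF r 0(1)], of \<eta>] nz show False by simp
    qed
    with 0 show ?case by blast
  next
    case (Suc N v)
    show ?case
    proof (cases "\<forall>r. 1 \<le> r \<longrightarrow> r < n \<longrightarrow> gt_E n m (Suc r) v = 0")
      case True
      with Suc.prems show ?thesis by blast
    next
      case False
      then obtain r where r: "1 \<le> r" "r < n" "gt_E n m (Suc r) v \<noteq> 0" by blast
      show ?thesis
      proof (rule Suc.IH)
        show "gt_E n m (Suc r) v \<in> W" using stable r Suc.prems by blast
        show "gt_E n m (Suc r) v \<noteq> 0" by fact
        fix \<eta> assume "gt_E n m (Suc r) v \<eta> \<noteq> 0"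
        then obtain \<xi> where "v \<xi> \<noteq> 0" "gt_degree n \<xi> = gt_degree n \<eta> + (- 1)"
          using gt_E_nonzero_source[of n m r v \<eta>] r by auto
        with Suc.prems(3)[of \<xi>] show "int b - int N \<le> gt_degree n \<eta>" by simp
      qed
    qed
  qed
  \<comment> \<open>The bound is -b, the lower end of the possible degrees.\<close>
  moreover have "gt_degree n \<xi> \<ge> int b - int (2 * b)" if "w \<xi> \<noteq> 0" for \<xi>
    using support[OF assms(3) that] by simp
  ultimately show thesis using assms(3,4) that by blast
qed

text \<open>A highest vector is supported on a single pattern, so a scalar multiple of it is the
  basis vector. The lemma serves both a submodule and its orthogonal complement.\<close>

lemma top_in_E_stable:
  assumes "\<And>r w. \<lbrakk>1 \<le> r; r < n; w \<in> W\<rbrakk> \<Longrightarrow> gt_E n m (Suc r) w \<in> W"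
    and "W \<subseteq> gt_space n m" "w \<in> W" "w \<noteq> 0" and "\<And>c w. w \<in> W \<Longrightarrow> gt_scale c w \<in> W"
  shows "gt_basis (gt_top n m) \<in> W"
proof -
  obtain u where u: "u \<in> W" "u \<noteq> 0" "\<And>r. \<lbrakk>1 \<le> r; r < n\<rbrakk> \<Longrightarrow> gt_E n m (Suc r) u = 0"
    using exists_highest_vector[of n W m w] assms by blast
  have support: "\<xi> = gt_top n m" if "u \<xi> \<noteq> 0" for \<xi>
    using highest_support[of u n m \<xi>] u assms(2) that by blast
  obtain \<xi> where "u \<xi> \<noteq> 0" using u(2) by (auto simp: fun_eq_iff)
  with support have nz: "u (gt_top n m) \<noteq> 0" by metis
  have "gt_scale (1 / u (gt_top n m)) u = gt_basis (gt_top n m)"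
  proof
    fix \<eta>
    show "gt_scale (1 / u (gt_top n m)) u \<eta> = gt_basis (gt_top n m) \<eta>"
      using support[of \<eta>] nz by (cases "\<eta> = gt_top n m") (auto simp: gt_scale_def gt_basis_def)
  qed
  with assms(5)[OF u(1), of "1 / u (gt_top n m)"] show ?thesis by simp
qed

section \<open>The bilinear form with the patterns as orthonormal basis\<close>

definition gt_form :: "nat \<Rightarrow> (nat \<Rightarrow> int) \<Rightarrow> gt_vec \<Rightarrow> gt_vec \<Rightarrow> complex" where
  "gt_form n m v w = (\<Sum>\<xi>\<in>gt_patterns n m. v \<xi> * w \<xi>)"

lemma gt_form_E_F:
  assumes "1 \<le> r"
  shows "gt_form n m (gt_E n m (Suc r) v) w = gt_form n m v (gt_F n m (Suc r) w)"
proof -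
  let ?P = "gt_patterns n m"
  let ?c = "\<lambda>j \<xi>. complex_of_real (gt_coeff n m r j \<xi>)"
  have "(\<Sum>\<eta>\<in>?P. ?c j (gt_shift j r (- 1) \<eta>) * v (gt_shift j r (- 1) \<eta>) * w \<eta>) =
      (\<Sum>\<xi>\<in>?P. v \<xi> * (?c j \<xi> * w (gt_shift j r 1 \<xi>)))" for j
    \<comment> \<open>Raising matches the summands except where the partner array is no pattern; the
      coefficient is 0 there, and these exceptions form \<open>S'\<close> and
      \<open>T'\<close>.\<close>
    by (rule sum.reindex_bij_witness_not_neutral[where i = "gt_shift j r 1" and j = "gt_shift j r (- 1)"
          and S' = "{\<eta> \<in> ?P. gt_shift j r (- 1) \<eta> \<notin> ?P}" and T' = "{\<xi> \<in> ?P. gt_shift j r 1 \<xi> \<notin> ?P}"])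
      (auto simp: gt_coeff_nonpattern)
  then have "(\<Sum>j = 1..r. \<Sum>\<eta>\<in>?P. ?c j (gt_shift j r (- 1) \<eta>) * v (gt_shift j r (- 1) \<eta>) * w \<eta>) =
      (\<Sum>j = 1..r. \<Sum>\<xi>\<in>?P. v \<xi> * (?c j \<xi> * w (gt_shift j r 1 \<xi>)))"
    by (rule sum.cong[OF refl])
  then show ?thesis
    unfolding gt_form_def gt_E_apply gt_F_apply[OF assms] sum_distrib_left sum_distrib_right
    by (subst (1 2) sum.swap)
qed

text \<open>A linear functional that vanishes on \<open>W\<close> but not at some vector outside it
  is represented, with respect to the form, by the vector of its values on the basis.\<close>

lemma exists_orthogonal_vector:
  assumes "module.subspace gt_scale W" "W \<subseteq> gt_space n m" "W \<noteq> gt_space n m"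
  obtains y where "y \<in> gt_space n m" "y \<noteq> 0" "\<And>w. w \<in> W \<Longrightarrow> gt_form n m y w = 0"
proof -
  interpret vector_space_pair gt_scale "(*) :: complex \<Rightarrow> complex \<Rightarrow> complex"
    by unfold_locales (auto simp: gt_scale_def algebra_simps)
  obtain x where x: "x \<in> gt_space n m" "x \<notin> W" using assms by blast
  obtain B where B: "B \<subseteq> W" "vs1.independent B" "W \<subseteq> vs1.span B"
    using vs1.maximal_independent_subset by blast
  have "vs1.span B \<subseteq> W" using B(1) assms(1) by (rule vs1.span_minimal)
  with x have "x \<notin> vs1.span B" by blast
  then have "vs1.independent (insert x B)" using B by (simp add: vs1.independent_insertI)
  then obtain g where g: "Vector_Spaces.linear gt_scale (*) g"
      "\<forall>z\<in>insert x B. g z = (if z = x then 1 else 0)"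
    using linear_independent_extend[of "insert x B" "\<lambda>z. if z = x then 1 else 0"] by blast
  interpret g: Vector_Spaces.linear gt_scale "(*)" g by (rule g(1))
  have "g z = 0" if "z \<in> B" for z
    using g(2) that B(1) x(2) by auto
  then have gW: "g w = 0" if "w \<in> W" for w
    using linear_eq_0_on_span[OF g(1)] B(3) that by blast
  define y where "y \<xi> = (if \<xi> \<in> gt_patterns n m then g (gt_basis \<xi>) else 0)" for \<xi>
  have form: "gt_form n m y w = g w" if "w \<in> gt_space n m" for w
  proof -
    have "w = (\<Sum>\<xi>\<in>gt_patterns n m. gt_scale (w \<xi>) (gt_basis \<xi>))"
    proof
      fix \<eta>
      have "(\<Sum>\<xi>\<in>gt_patterns n m. gt_scale (w \<xi>) (gt_basis \<xi>)) \<eta> =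
          (\<Sum>\<xi>\<in>gt_patterns n m. if \<eta> = \<xi> then w \<xi> else 0)"
        unfolding sum_fun_apply by (intro sum.cong) (auto simp: gt_scale_def gt_basis_def)
      with that show "w \<eta> = (\<Sum>\<xi>\<in>gt_patterns n m. gt_scale (w \<xi>) (gt_basis \<xi>)) \<eta>"
        by (simp add: gt_space_def)
    qed
    then have "g w = (\<Sum>\<xi>\<in>gt_patterns n m. w \<xi> * g (gt_basis \<xi>))"
      by (metis (no_types, lifting) g.sum g.scale sum.cong)
    then show ?thesis unfolding gt_form_def y_def by (simp add: mult.commute)
  qed
  show thesis
  proof
    show "y \<in> gt_space n m" by (simp add: y_def gt_space_def)
    show "y \<noteq> 0" using form[OF x(1)] g(2) by (auto simp: gt_form_def)
    show "gt_form n m y w = 0" if "w \<in> W" for w using form gW that assms(2) by auto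
  qed
qed

text \<open>An off-diagonal matrix unit has trace 0, so a submodule is stable under each E_r and F_r
  separately.\<close>

lemma gt_action_elementary:
  assumes "1 \<le> p" "p \<le> n" "1 \<le> q" "q \<le> n" "p \<noteq> q"
  obtains X where "X \<in> sl n" "\<And>v. gt_action n m X v = gt_unit n m p q v"
proof
  define X :: "complex mat" where "X = mat n n (\<lambda>(i, j). if i = p - 1 \<and> j = q - 1 then 1 else 0)"
  show X: "X \<in> sl n" using assms by (auto simp: sl_def X_def intro!: sum.neutral)
  fix v
  show "gt_action n m X v = gt_unit n m p q v"
  proof
    fix \<eta>
    have "gt_action n m X v \<eta> = (\<Sum>a\<in>{1..n} \<times> {1..n}. if a = (p, q) then app_op (unit_op n m p q) v \<eta> else 0)"
      using assms(1) X unfolding gt_action_apply[OF X order_trans[OF assms(1,2)]]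
      by (intro sum.cong refl) (use assms in \<open>auto simp: X_def eq_diff_iff split: if_splits\<close>)
    then show "gt_action n m X v \<eta> = gt_unit n m p q v \<eta>"
      using assms by (simp add: app_unit_op)
  qed
qed

theorem theorem4p1p1:
  fixes n :: nat and m :: "nat \<Rightarrow> int"
  assumes "n \<ge> 2"
    and "\<And>i. 1 \<le> i \<Longrightarrow> i < n \<Longrightarrow> m i \<ge> m (i + 1)"
  shows "simple_sl_module gt_scale n (gt_space n m) (gt_action n m)"
proof -
  interpret sl_module gt_scale n "gt_space n m" "gt_action n m"
    using assms(1) by (intro sl_module_gt) simp
  let ?t = "gt_basis (gt_top n m)"
  have top: "gt_top n m \<in> gt_patterns n m" using assms(2) by (rule gt_top_pattern)
  show ?thesis
  proof
    show "gt_space n m \<noteq> {0}"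
    proof
      assume "gt_space n m = {0}"
      moreover have "?t \<in> gt_space n m" using top by (auto simp: gt_basis_def gt_space_def)
      ultimately have "?t (gt_top n m) = 0" by simp
      then show False by (simp add: gt_basis_def)
    qed
  next
    fix W assume "submodule W"
    then have W: "W \<subseteq> gt_space n m" "subspace W" and stable: "\<And>X w. \<lbrakk>X \<in> sl n; w \<in> W\<rbrakk> \<Longrightarrow> gt_action n m X w \<in> W"
      by (auto simp: submodule_def)
    have E: "gt_E n m (Suc r) w \<in> W" if r: "1 \<le> r" "r < n" and "w \<in> W" for r w
    proof -
      obtain X where "X \<in> sl n" "gt_action n m X w = gt_unit n m r (Suc r) w"
        using gt_action_elementary[of r n "Suc r" m] r by auto
      with stable[of X w] that show ?thesis by (simp add: gt_unit.simps[of n m r "Suc r"])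
    qed
    have F: "gt_F n m (Suc r) w \<in> W" if r: "1 \<le> r" "r < n" and "w \<in> W" for r w
    proof -
      obtain X where "X \<in> sl n" "gt_action n m X w = gt_unit n m (Suc r) r w"
        using gt_action_elementary[of "Suc r" n r m] r by auto
      with stable[of X w] that show ?thesis by (simp add: gt_unit.simps[of n m "Suc r" r])
    qed
    show "W = {0} \<or> W = gt_space n m"
    proof (rule ccontr)
      assume "\<not> (W = {0} \<or> W = gt_space n m)"
      then obtain w where w: "w \<in> W" "w \<noteq> 0" and "W \<noteq> gt_space n m"
        using subspace_0[OF W(2)] by blast
      obtain y where y: "y \<in> gt_space n m" "y \<noteq> 0" "\<And>w. w \<in> W \<Longrightarrow> gt_form n m y w = 0"
        using exists_orthogonal_vector[OF W(2,1) \<open>W \<noteq> gt_space n m\<close>] by blast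
      have "?t \<in> W"
        using top_in_E_stable[OF E W(1) w] subspace_scale[OF W(2)] by blast
      moreover have "?t \<in> {y \<in> gt_space n m. \<forall>w\<in>W. gt_form n m y w = 0}"
      proof (rule top_in_E_stable)
        fix r v assume "1 \<le> r" "r < n" "v \<in> {y \<in> gt_space n m. \<forall>w\<in>W. gt_form n m y w = 0}"
        then show "gt_E n m (Suc r) v \<in> {y \<in> gt_space n m. \<forall>w\<in>W. gt_form n m y w = 0}"
          using F by (auto simp: gt_form_E_F gt_space_def gt_E_outside)
      next
        fix c v assume "v \<in> {y \<in> gt_space n m. \<forall>w\<in>W. gt_form n m y w = 0}"
        then show "gt_scale c v \<in> {y \<in> gt_space n m. \<forall>w\<in>W. gt_form n m y w = 0}"
          by (simp add: gt_space_def gt_form_def gt_scale_def mult.assoc flip: sum_distrib_left)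
      qed (use y in auto)
      ultimately have "gt_form n m ?t ?t = 0" by blast
      moreover have "gt_form n m ?t ?t = (\<Sum>\<xi>\<in>gt_patterns n m. if \<xi> = gt_top n m then 1 else 0)"
        unfolding gt_form_def by (intro sum.cong) (auto simp: gt_basis_def)
      ultimately show False using top by simp
    qed
  qed
qed

end
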